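(* Let $q$ be a prime power, $n\ge 2$, and $m,d\ge 1$ integers. Every $(m,d)$-Hyper-Furstenberg set $S\subseteq\mathbb{F}_q^n$ satisfies $$|S|\ge C_{n,d}\, m^{n/(n-1)},\qquad\text{where } C_{n,d}=\big(16\, d^{n/(n-1)}\big)^{-1}.$$
   Context: $\mathbb{F}_q$ is the finite field with $q$ elements. A hypersurface $\{x: f(x)=0\}$ for $f\in\mathbb{F}_q[x_1,\dots,x_n]$ is called $(S,m)$-rich if it contains at least $m$ points of $S$. A set $S\subseteq\mathbb{F}_q^n$ is called $(m,d)$-Hyper-Furstenberg if for every linear form $h(x)=h_1x_1+\dots+h_nx_n$ with $h_i\in\mathbb{F}_q$ there exists a polynomial $g\in\mathbb{F}_q[x_1,\dots,x_n]$ of degree at most $d-1$ such that the zero set of $h^d+g$ contains at least $m$ points of $S$. *)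

theory Defs
  imports "HOL-Analysis.Analysis" "HOL-Library.Poly_Mapping"
begin

text \<open>
  A polynomial over \<open>'a\<close> in the variables \<open>x\<^sub>i\<close>, \<open>i :: 'n\<close>, is a finitely supported map from
  exponent vectors \<open>'n \<Rightarrow>\<^sub>0 nat\<close> to coefficients; \<^typ>\<open>('n \<Rightarrow>\<^sub>0 nat) \<Rightarrow>\<^sub>0 'a\<close> carries the polynomial
  ring structure (multiplication is convolution) from the library.
\<close>

type_synonym ('n, 'a) mvpoly = "('n \<Rightarrow>\<^sub>0 nat) \<Rightarrow>\<^sub>0 'a"

definition mv_const :: "'a::zero \<Rightarrow> ('n, 'a) mvpoly"
  where "mv_const c = Poly_Mapping.single 0 c"

definition mv_var :: "'n \<Rightarrow> ('n, 'a::zero_neq_one) mvpoly"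
  where "mv_var i = Poly_Mapping.single (Poly_Mapping.single i 1) 1"

definition mv_eval :: "('n::finite, 'a::comm_semiring_1) mvpoly \<Rightarrow> 'a ^ 'n \<Rightarrow> 'a"
  where "mv_eval f x =
    (\<Sum>\<alpha>\<in>Poly_Mapping.keys f. Poly_Mapping.lookup f \<alpha> * (\<Prod>i\<in>UNIV. (x $ i) ^ Poly_Mapping.lookup \<alpha> i))"

text \<open>Total degree; the zero polynomial gets degree \<open>0\<close>, so it satisfies every bound on the degree.\<close>

definition mv_degree :: "('n::finite, 'a::zero) mvpoly \<Rightarrow> nat"
  where "mv_degree f = Max (insert 0 ((\<lambda>\<alpha>. \<Sum>i\<in>UNIV. Poly_Mapping.lookup \<alpha> i) ` Poly_Mapping.keys f))"

definition linear_form :: "'a::comm_semiring_1 ^ 'n \<Rightarrow> ('n::finite, 'a) mvpoly"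
  where "linear_form h = (\<Sum>i\<in>UNIV. mv_const (h $ i) * mv_var i)"

definition hypersurface :: "('n::finite, 'a::comm_semiring_1) mvpoly \<Rightarrow> ('a ^ 'n) set"
  where "hypersurface f = {x. mv_eval f x = 0}"

definition rich :: "('a ^ 'n) set \<Rightarrow> nat \<Rightarrow> ('n::finite, 'a::{finite,field}) mvpoly \<Rightarrow> bool"
  where "rich S m f \<longleftrightarrow> m \<le> card (hypersurface f \<inter> S)"

definition hyper_furstenberg :: "nat \<Rightarrow> nat \<Rightarrow> ('a::{finite,field} ^ 'n::finite) set \<Rightarrow> bool"
  where "hyper_furstenberg m d S \<longleftrightarrow>
    (\<forall>h :: 'a ^ 'n. \<exists>g :: ('n, 'a) mvpoly. mv_degree g \<le> d - 1 \<and> rich S m (linear_form h ^ d + g))"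

lemma mv_eval_superset:
  assumes "finite A" "Poly_Mapping.keys f \<subseteq> A"
  shows "mv_eval f x =
    (\<Sum>\<alpha>\<in>A. Poly_Mapping.lookup f \<alpha> * (\<Prod>i\<in>UNIV. (x $ i) ^ Poly_Mapping.lookup \<alpha> i))"
  unfolding mv_eval_def
  by (rule sum.mono_neutral_left) (use assms in \<open>auto simp: in_keys_iff\<close>)

lemma mv_eval_single:
  "mv_eval (Poly_Mapping.single \<alpha> c) x = c * (\<Prod>i\<in>UNIV. (x $ i) ^ Poly_Mapping.lookup \<alpha> i)"
  by (subst mv_eval_superset[of "{\<alpha>}"]) auto

lemma mv_eval_0 [simp]: "mv_eval 0 x = 0"
  by (simp add: mv_eval_def)

lemma mv_eval_const [simp]: "mv_eval (mv_const c) x = c"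
  by (simp add: mv_const_def mv_eval_single)

lemma mv_eval_1 [simp]: "mv_eval 1 x = 1"
  using mv_eval_const[of 1 x] by (simp add: mv_const_def)

lemma mv_eval_var [simp]: "mv_eval (mv_var i) x = x $ i"
proof -
  have "(\<Prod>j\<in>UNIV. (x $ j) ^ (1 when i = j)) = (\<Prod>j\<in>UNIV. if i = j then x $ j else 1)"
    by (rule prod.cong) (auto simp: when_def)
  then show ?thesis
    by (simp add: mv_var_def mv_eval_single lookup_single)
qed

lemma mv_eval_add [simp]: "mv_eval (f + g) x = mv_eval f x + mv_eval g x"
  using Poly_Mapping.keys_add[of f g]
  by (simp add: mv_eval_superset[of "Poly_Mapping.keys f \<union> Poly_Mapping.keys g"]
      lookup_add distrib_right sum.distrib)

lemma mv_eval_sum [simp]: "mv_eval (sum F A) x = (\<Sum>a\<in>A. mv_eval (F a) x)"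
  by (induction A rule: infinite_finite_induct) auto

lemma mv_eval_mult [simp]:
  fixes f g :: "('n::finite, 'a::comm_semiring_1) mvpoly"
  shows "mv_eval (f * g) x = mv_eval f x * mv_eval g x"
proof -
  have expand: "p = (\<Sum>\<alpha>\<in>Poly_Mapping.keys p. Poly_Mapping.single \<alpha> (Poly_Mapping.lookup p \<alpha>))"
    for p :: "('n, 'a) mvpoly"
    by (rule poly_mapping_eqI)
      (auto simp: lookup_sum lookup_single when_def in_keys_iff)
  have mono: "mv_eval (Poly_Mapping.single \<alpha> a * Poly_Mapping.single \<beta> b) x =
      mv_eval (Poly_Mapping.single \<alpha> a) x * mv_eval (Poly_Mapping.single \<beta> b) x" for \<alpha> \<beta> a b
    by (simp add: mult_single mv_eval_single lookup_add power_add prod.distrib mult_ac)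
  let ?s = "\<lambda>p. \<Sum>\<alpha>\<in>Poly_Mapping.keys p. Poly_Mapping.single \<alpha> (Poly_Mapping.lookup p \<alpha>)"
  have "mv_eval (?s f * ?s g) x = mv_eval (?s f) x * mv_eval (?s g) x"
    by (simp only: sum_product mv_eval_sum mono)
  then show ?thesis
    by (simp only: expand[symmetric])
qed

lemma mv_eval_power [simp]: "mv_eval (f ^ k) x = mv_eval f x ^ k"
  by (induction k) auto

lemma mv_eval_linear_form [simp]: "mv_eval (linear_form h) x = (\<Sum>i\<in>UNIV. h $ i * x $ i)"
  by (simp add: linear_form_def)

end

theory Submission
  imports Defs
begin

text \<open>
  For an ideal \<open>J\<close> of \<open>R = F\<^sub>q[x\<^sub>1, \<dots>, x\<^sub>n]\<close> let \<open>\<ell>(J) = dim R/J\<close>. If \<open>J\<close> is the ideal of top-degree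
  forms of the vanishing ideal of \<open>S\<close>, then \<open>\<ell>(J) = |S|\<close>, and richness of \<open>h^d + g\<close> gives
  \<open>m \<le> \<ell>(J + (h^d)) \<le> d \<ell>(J + (h))\<close>: passing to top-degree forms forgets \<open>g\<close>, and the exponent
  \<open>d\<close> only costs a factor. So it suffices to bound the average over all linear forms \<open>h\<close> of
  \<open>\<ell>(J + (h))\<close> from above in terms of \<open>\<ell>(J)\<close>.

  This rests on \<open>\<ell>(J) = \<ell>(J + (g)) + \<ell>(J : g)\<close>. Since \<open>(J : g) + (h) \<subseteq> (J + (h)) : g\<close>,
  we get \<open>\<ell>((J : g) + (h)) \<ge> \<ell>(J + (h)) - \<ell>(J + (h) + (g))\<close> for linear forms \<open>g\<close>, \<open>h\<close>.
  Averaging over \<open>g\<close> and \<open>h\<close> relates \<open>J\<close> to the ideals \<open>J : g\<close>, which have smaller colength, and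
  \<open>J + (h)\<close>, which live in one variable less. The induction is run on a family of linear
  inequalities with an integer parameter \<open>T\<close>, the tangents to the concave bound
  \<open>\<ell>(J)\<close> to the power \<open>(n - 1)/n\<close>, because linear inequalities survive averaging.
\<close>

section \<open>Ideals of finite index\<close>

definition is_ideal :: "'r::comm_ring_1 set \<Rightarrow> bool"
  where "is_ideal J \<longleftrightarrow> 0 \<in> J \<and> (\<forall>x\<in>J. \<forall>y\<in>J. x + y \<in> J) \<and> (\<forall>r. \<forall>x\<in>J. r * x \<in> J)"

definition adjoin :: "'r::comm_ring_1 set \<Rightarrow> 'r \<Rightarrow> 'r set"
  where "adjoin J g = {x + r * g | x r. x \<in> J}"

definition colon :: "'r::comm_ring_1 set \<Rightarrow> 'r \<Rightarrow> 'r set"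
  where "colon J g = {r. r * g \<in> J}"

text \<open>For an ideal \<open>K\<close> the condition under the choice depends only on the coset
  of \<open>x\<close>, so the range is a set of representatives for R/K. Counting it stands in for
  counting the quotient ring.\<close>

definition coset_rep :: "'r::comm_ring_1 set \<Rightarrow> 'r \<Rightarrow> 'r"
  where "coset_rep K x = (SOME y. y - x \<in> K)"

definition finite_index :: "'r::comm_ring_1 set \<Rightarrow> bool"
  where "finite_index K \<longleftrightarrow> finite (range (coset_rep K))"

definition ideal_index :: "'r::comm_ring_1 set \<Rightarrow> nat"
  where "ideal_index K = card (range (coset_rep K))"

lemma ideal_zero: "is_ideal J \<Longrightarrow> 0 \<in> J"
  and ideal_add: "is_ideal J \<Longrightarrow> x \<in> J \<Longrightarrow> y \<in> J \<Longrightarrow> x + y \<in> J"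
  and ideal_mult: "is_ideal J \<Longrightarrow> x \<in> J \<Longrightarrow> r * x \<in> J"
  by (auto simp: is_ideal_def)

lemma ideal_mult_right: "is_ideal J \<Longrightarrow> x \<in> J \<Longrightarrow> x * r \<in> J"
  using ideal_mult[of J x r] by (simp add: mult.commute)

lemma ideal_uminus: "is_ideal J \<Longrightarrow> x \<in> J \<Longrightarrow> - x \<in> J"
  using ideal_mult[of J x "-1"] by simp

lemma ideal_diff_commute: "is_ideal J \<Longrightarrow> x - y \<in> J \<longleftrightarrow> y - x \<in> J"
  using ideal_uminus[of J "x - y"] ideal_uminus[of J "y - x"] by auto

lemma ideal_diff_trans: "is_ideal J \<Longrightarrow> x - y \<in> J \<Longrightarrow> y - z \<in> J \<Longrightarrow> x - z \<in> J"
  using ideal_add[of J "x - y" "y - z"] by simp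

lemma ideal_sum: "is_ideal J \<Longrightarrow> (\<And>a. a \<in> A \<Longrightarrow> f a \<in> J) \<Longrightarrow> sum f A \<in> J"
  by (induction A rule: infinite_finite_induct) (auto intro: ideal_zero ideal_add)

lemma is_ideal_adjoin:
  assumes "is_ideal J" shows "is_ideal (adjoin J g)"
  unfolding is_ideal_def
proof (intro conjI ballI allI)
  show "0 \<in> adjoin J g"
    using ideal_zero[OF assms] unfolding adjoin_def by (metis (mono_tags, lifting) add_0 mem_Collect_eq mult_zero_left)
  fix x y r assume x: "x \<in> adjoin J g"
  from x obtain a b where ab: "x = a + b * g" "a \<in> J" by (auto simp: adjoin_def)
  have "r * x = r * a + (r * b) * g" using ab by (simp add: algebra_simps)
  then show "r * x \<in> adjoin J g"
    using ideal_mult[OF assms ab(2)] unfolding adjoin_def by blast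
  assume "y \<in> adjoin J g"
  then obtain c d where cd: "y = c + d * g" "c \<in> J" by (auto simp: adjoin_def)
  have "x + y = (a + c) + (b + d) * g" using ab cd by (simp add: algebra_simps)
  then show "x + y \<in> adjoin J g"
    using ideal_add[OF assms ab(2) cd(2)] unfolding adjoin_def by blast
qed

lemma is_ideal_colon:
  assumes "is_ideal J" shows "is_ideal (colon J g)"
  using assms by (auto simp: is_ideal_def colon_def distrib_right mult.assoc)

lemma subset_adjoin: "J \<subseteq> adjoin J g"
proof
  fix x assume "x \<in> J"
  then show "x \<in> adjoin J g"
    unfolding adjoin_def by (metis (mono_tags, lifting) add.right_neutral mem_Collect_eq mult_zero_left)
qed

lemma mem_adjoin: "is_ideal J \<Longrightarrow> g \<in> adjoin J g"
  unfolding adjoin_def using ideal_zero[of J]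
  by (metis (mono_tags, lifting) add_0 mem_Collect_eq mult_1)

lemma adjoin_subset: "is_ideal K \<Longrightarrow> J \<subseteq> K \<Longrightarrow> g \<in> K \<Longrightarrow> adjoin J g \<subseteq> K"
  by (auto simp: adjoin_def intro!: ideal_add ideal_mult)

lemma subset_colon: "is_ideal J \<Longrightarrow> J \<subseteq> colon J g"
  by (auto simp: colon_def intro: ideal_mult_right)

lemma adjoin_colon_subset:
  assumes "is_ideal J"
  shows "adjoin (colon J g) h \<subseteq> colon (adjoin J h) g"
proof (rule adjoin_subset)
  show "is_ideal (colon (adjoin J h) g)"
    by (intro is_ideal_colon is_ideal_adjoin assms)
  show "colon J g \<subseteq> colon (adjoin J h) g"
    using subset_adjoin[of J h] by (auto simp: colon_def)
  show "h \<in> colon (adjoin J h) g"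
    using ideal_mult[OF is_ideal_adjoin[OF assms] mem_adjoin[OF assms]]
    by (simp add: colon_def mult.commute)
qed

lemma coset_rep_diff: "is_ideal K \<Longrightarrow> coset_rep K x - x \<in> K"
  unfolding coset_rep_def by (rule someI[of _ x]) (simp add: ideal_zero)

lemma coset_rep_eq_iff:
  assumes "is_ideal K"
  shows "coset_rep K x = coset_rep K y \<longleftrightarrow> x - y \<in> K"
proof
  assume eq: "coset_rep K x = coset_rep K y"
  have "x - coset_rep K x \<in> K"
    using coset_rep_diff[OF assms, of x] ideal_diff_commute[OF assms] by blast
  then show "x - y \<in> K"
    using coset_rep_diff[OF assms, of y] unfolding eq by (rule ideal_diff_trans[OF assms])
next
  assume xy: "x - y \<in> K"
  then have yx: "y - x \<in> K" using ideal_diff_commute[OF assms] by blast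
  have "z - x \<in> K \<longleftrightarrow> z - y \<in> K" for z
    using ideal_diff_trans[OF assms _ xy, of z] ideal_diff_trans[OF assms _ yx, of z] by blast
  then show "coset_rep K x = coset_rep K y"
    by (simp add: coset_rep_def)
qed

lemma coset_rep_range_inj:
  assumes "is_ideal K" "a \<in> range (coset_rep K)" "b \<in> range (coset_rep K)" "a - b \<in> K"
  shows "a = b"
proof -
  obtain x y where xy: "a = coset_rep K x" "b = coset_rep K y" using assms(2,3) by blast
  have "coset_rep K a = a" "coset_rep K b = b"
    unfolding xy by (simp_all add: coset_rep_eq_iff coset_rep_diff assms(1))
  moreover have "coset_rep K a = coset_rep K b"
    using assms(1,4) by (simp add: coset_rep_eq_iff)
  ultimately show ?thesis by metis
qed

text \<open>Allows convenient normal forms to be counted instead of the chosen representatives: sums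
  \<open>a + b * g\<close> for the index formula, and polynomials free of leading monomials for
  initial ideals.\<close>

lemma transversal_bij_betw:
  assumes "is_ideal K"
    and "\<And>x. \<exists>c\<in>C. x - c \<in> K"
    and "\<And>c c'. c \<in> C \<Longrightarrow> c' \<in> C \<Longrightarrow> c - c' \<in> K \<Longrightarrow> c = c'"
  shows "bij_betw (coset_rep K) C (range (coset_rep K))"
proof (rule bij_betwI')
  fix x y assume "x \<in> C" "y \<in> C"
  then show "coset_rep K x = coset_rep K y \<longleftrightarrow> x = y"
    using assms(3)[of x y] ideal_zero[OF assms(1)] by (auto simp: coset_rep_eq_iff[OF assms(1)])
next
  fix y assume "y \<in> range (coset_rep K)"
  then obtain x where x: "y = coset_rep K x" by blast
  obtain c where "c \<in> C" "x - c \<in> K" using assms(2) by blast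
  then show "\<exists>c\<in>C. y = coset_rep K c" using x coset_rep_eq_iff[OF assms(1)] by blast
qed simp

text \<open>Congruence modulo \<open>J\<close> implies congruence modulo \<open>K\<close>, so R/J
  maps onto R/K. Monotonicity of finiteness and of the index both follow.\<close>

lemma coset_rep_image:
  assumes "is_ideal J" "is_ideal K" "J \<subseteq> K"
  shows "range (coset_rep K) = coset_rep K ` range (coset_rep J)"
proof -
  have "coset_rep K x = coset_rep K (coset_rep J x)" for x
    using coset_rep_diff[OF assms(1), of x] assms(3) coset_rep_eq_iff[OF assms(2), of "coset_rep J x" x]
    by auto
  then show ?thesis by (auto simp: image_image)
qed

lemma finite_index_mono:
  "is_ideal J \<Longrightarrow> is_ideal K \<Longrightarrow> J \<subseteq> K \<Longrightarrow> finite_index J \<Longrightarrow> finite_index K"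
  by (simp add: finite_index_def coset_rep_image[of J K])

lemma ideal_index_mono:
  "is_ideal J \<Longrightarrow> is_ideal K \<Longrightarrow> J \<subseteq> K \<Longrightarrow> finite_index J \<Longrightarrow> ideal_index K \<le> ideal_index J"
  by (simp add: ideal_index_def finite_index_def coset_rep_image[of J K] card_image_le)

lemma ideal_index_pos: "finite_index J \<Longrightarrow> ideal_index J > 0"
  by (simp add: ideal_index_def finite_index_def card_gt_0_iff)

text \<open>Multiplication by \<open>g\<close> embeds R/(J : g) into R/J with cokernel R/(J + (g)).
  Concretely, the sums \<open>a + b * g\<close> of representatives of the two quotients form a
  transversal of \<open>J\<close>.\<close>

lemma ideal_index_adjoin_colon:
  assumes J: "is_ideal J"
  shows "ideal_index J = ideal_index (adjoin J g) * ideal_index (colon J g)"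
proof -
  let ?K = "adjoin J g" and ?C = "colon J g"
  note K = is_ideal_adjoin[OF J, of g] and C = is_ideal_colon[OF J, of g]
  let ?f = "\<lambda>(a, b). a + b * g"
  \<comment> \<open>Reduction modulo J + (g) determines \<open>a\<close>. Once
    \<open>a = a'\<close>, what remains is \<open>(b - b') * g \<in> J\<close>, which says that
    \<open>b - b'\<close> lies in J : g.\<close>
  have inj: "a = a' \<and> b = b'"
    if a: "a \<in> range (coset_rep ?K)" "a' \<in> range (coset_rep ?K)"
      and b: "b \<in> range (coset_rep ?C)" "b' \<in> range (coset_rep ?C)"
      and *: "(a + b * g) - (a' + b' * g) \<in> J" for a a' b b'
  proof -
    have "a - a' = ((a + b * g) - (a' + b' * g)) + (b' - b) * g"
      by (simp add: algebra_simps)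
    then have "a - a' \<in> ?K" using * unfolding adjoin_def by blast
    then have eq: "a = a'"
      by (rule coset_rep_range_inj[OF K a])
    then have "b - b' \<in> ?C" using * by (simp add: colon_def algebra_simps)
    then show ?thesis
      using eq coset_rep_range_inj[OF C b] by blast
  qed
  have injf: "inj_on ?f (range (coset_rep ?K) \<times> range (coset_rep ?C))"
  proof (rule inj_onI)
    fix u v
    assume u: "u \<in> range (coset_rep ?K) \<times> range (coset_rep ?C)"
      and v: "v \<in> range (coset_rep ?K) \<times> range (coset_rep ?C)" and "?f u = ?f v"
    then have "(fst u + snd u * g) - (fst v + snd v * g) \<in> J"
      using ideal_zero[OF J] by (simp add: case_prod_beta)
    then have "fst u = fst v \<and> snd u = snd v"
      using u v by (intro inj) (simp_all add: mem_Times_iff)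
    then show "u = v" by (simp add: prod_eq_iff)
  qed
  have "bij_betw (coset_rep J) (?f ` (range (coset_rep ?K) \<times> range (coset_rep ?C)))
      (range (coset_rep J))"
  proof (rule transversal_bij_betw[OF J])
    fix x
    have "x - coset_rep ?K x \<in> ?K"
      using coset_rep_diff[OF K] ideal_diff_commute[OF K] by blast
    then obtain j r where jr: "x - coset_rep ?K x = j + r * g" "j \<in> J"
      by (auto simp: adjoin_def)
    have "r - coset_rep ?C r \<in> ?C"
      using coset_rep_diff[OF C] ideal_diff_commute[OF C] by blast
    then have "j + (r - coset_rep ?C r) * g \<in> J"
      using ideal_add[OF J jr(2)] by (simp add: colon_def)
    also have "j + (r - coset_rep ?C r) * g = x - (coset_rep ?K x + coset_rep ?C r * g)"
      using jr(1) by (simp add: algebra_simps)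
    finally show "\<exists>c\<in>?f ` (range (coset_rep ?K) \<times> range (coset_rep ?C)). x - c \<in> J"
      by (intro bexI[of _ "?f (coset_rep ?K x, coset_rep ?C r)"]) auto
  next
    fix c c'
    assume c: "c \<in> ?f ` (range (coset_rep ?K) \<times> range (coset_rep ?C))"
      and c': "c' \<in> ?f ` (range (coset_rep ?K) \<times> range (coset_rep ?C))" and "c - c' \<in> J"
    obtain a b where ab: "c = a + b * g" "a \<in> range (coset_rep ?K)" "b \<in> range (coset_rep ?C)"
      using c by (elim imageE SigmaE) simp
    obtain a' b' where ab': "c' = a' + b' * g" "a' \<in> range (coset_rep ?K)"
        "b' \<in> range (coset_rep ?C)"
      using c' by (elim imageE SigmaE) simp
    show "c = c'"
      using inj[OF ab(2) ab'(2) ab(3) ab'(3)] \<open>c - c' \<in> J\<close> ab(1) ab'(1) by simp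
  qed
  then have "ideal_index J = card (?f ` (range (coset_rep ?K) \<times> range (coset_rep ?C)))"
    unfolding ideal_index_def by (metis bij_betw_same_card)
  then show ?thesis
    by (simp add: card_image[OF injf] card_cartesian_product ideal_index_def)
qed

section \<open>Colength of polynomial ideals over a finite field\<close>

text \<open>R/J is a vector space over the field with q elements, so when finite it has q to the
  power dim R/J elements. The logarithm recovers the dimension and turns the index formula into
  additivity.\<close>

definition colength :: "('n::finite, 'a::{finite,field}) mvpoly set \<Rightarrow> real"
  where "colength J = log (real CARD('a)) (real (ideal_index J))"

lemma card_field_ge_2: "CARD('a::{finite,field}) \<ge> 2"
  using card_mono[of "UNIV :: 'a set" "{0, 1}"] by simp

lemma colength_mono:
  fixes J K :: "('n::finite, 'a::{finite,field}) mvpoly set"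
  assumes "is_ideal J" "is_ideal K" "J \<subseteq> K" "finite_index J"
  shows "colength K \<le> colength J"
  unfolding colength_def using card_field_ge_2[where 'a='a]
    ideal_index_mono[OF assms] ideal_index_pos[OF finite_index_mono[OF assms]]
  by simp

lemma colength_nonneg:
  fixes J :: "('n::finite, 'a::{finite,field}) mvpoly set"
  assumes "finite_index J"
  shows "colength J \<ge> 0"
  unfolding colength_def using card_field_ge_2[where 'a='a] ideal_index_pos[OF assms]
  by simp

lemma colength_adjoin_colon:
  fixes J :: "('n::finite, 'a::{finite,field}) mvpoly set"
  assumes "is_ideal J" "finite_index J"
  shows "colength J = colength (adjoin J g) + colength (colon J g)"
proof -
  have "ideal_index (adjoin J g) > 0" "ideal_index (colon J g) > 0"
    using assms
    by (auto intro!: ideal_index_pos finite_index_mono[OF assms(1) _ _ assms(2)]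
        is_ideal_adjoin is_ideal_colon subset_adjoin subset_colon)
  then show ?thesis
    unfolding colength_def ideal_index_adjoin_colon[OF assms(1), of g]
    using card_field_ge_2[where 'a='a] by (simp add: log_mult)
qed

lemma colength_eq_0:
  fixes J :: "('n::finite, 'a::{finite,field}) mvpoly set"
  assumes "is_ideal J" "1 \<in> J"
  shows "colength J = 0"
proof -
  have "x \<in> J" for x using ideal_mult[OF assms, of x] by simp
  then have "range (coset_rep J) = {coset_rep J 0}"
    using coset_rep_eq_iff[OF assms(1)] by blast
  then show ?thesis by (simp add: colength_def ideal_index_def)
qed

text \<open>Induction on the exponent through J : h, which contains the next lower power of
  \<open>h\<close>. The additivity formula peels off one copy of \<ell>(J + (h)), and \<ell>((J : h)
  + (h)) is at most \<ell>(J + (h)).\<close>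

lemma colength_le_power:
  fixes J :: "('n::finite, 'a::{finite,field}) mvpoly set"
  assumes "is_ideal J" "finite_index J" "h ^ d \<in> J"
  shows "colength J \<le> real d * colength (adjoin J h)"
  using assms
proof (induction d arbitrary: J)
  case 0
  then show ?case by (simp add: colength_eq_0)
next
  case (Suc d)
  note C = is_ideal_colon[OF Suc.prems(1), of h]
  have fin: "finite_index (colon J h)" "finite_index (adjoin J h)"
    using Suc.prems(1,2)
    by (auto intro!: finite_index_mono[OF Suc.prems(1) _ _ Suc.prems(2)]
        C is_ideal_adjoin subset_adjoin subset_colon)
  have "h ^ d \<in> colon J h" using Suc.prems(3) by (simp add: colon_def mult.commute)
  then have "colength (colon J h) \<le> real d * colength (adjoin (colon J h) h)"
    by (rule Suc.IH[OF C fin(1)])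
  also have "\<dots> \<le> real d * colength (adjoin J h)"
  proof (intro mult_left_mono colength_mono fin is_ideal_adjoin C Suc.prems)
    show "adjoin J h \<subseteq> adjoin (colon J h) h"
      using subset_colon[OF Suc.prems(1), of h] by (auto simp: adjoin_def)
  qed simp
  finally show ?case
    using colength_adjoin_colon[OF Suc.prems(1,2), of h] by (simp add: algebra_simps)
qed

section \<open>Linear forms contained in an ideal\<close>

lemma mv_const_add: "mv_const (a + b) = mv_const a + mv_const b"
  by (simp add: mv_const_def single_add)

lemma mv_const_mult: "mv_const (a * b) = mv_const a * mv_const b"
  by (simp add: mv_const_def mult_single)

lemma linear_form_add: "linear_form (u + v) = linear_form u + linear_form v"
  by (simp add: linear_form_def mv_const_add distrib_right sum.distrib)

lemma linear_form_scale: "linear_form (c *s v) = mv_const c * linear_form v"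
  by (simp add: linear_form_def mv_const_mult sum_distrib_left mult.assoc)

lemma linear_form_axis: "linear_form (axis i 1) = mv_var i"
proof -
  have "linear_form (axis i 1) = (\<Sum>j\<in>UNIV. if j = i then mv_var j else 0)"
    unfolding linear_form_def by (rule sum.cong) (auto simp: axis_def mv_const_def)
  then show ?thesis by simp
qed

text \<open>For an ideal this is a subspace of the coefficient space, and its codimension is the
  number of linear forms that suffice to generate R/J. Its size is tracked by cardinality instead of
  dimension.\<close>

definition linear_part :: "('n::finite, 'a::{finite,field}) mvpoly set \<Rightarrow> ('a ^ 'n) set"
  where "linear_part J = {v. linear_form v \<in> J}"

lemma linear_part_mono: "J \<subseteq> K \<Longrightarrow> linear_part J \<subseteq> linear_part K"
  by (auto simp: linear_part_def)

lemma zero_in_linear_part: "is_ideal J \<Longrightarrow> 0 \<in> linear_part J"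
  by (simp add: linear_part_def linear_form_def mv_const_def ideal_zero)

lemma linear_part_add:
  "is_ideal J \<Longrightarrow> u \<in> linear_part J \<Longrightarrow> v \<in> linear_part J \<Longrightarrow> u + v \<in> linear_part J"
  by (simp add: linear_part_def linear_form_add ideal_add)

lemma linear_part_scale: "is_ideal J \<Longrightarrow> v \<in> linear_part J \<Longrightarrow> c *s v \<in> linear_part J"
  by (simp add: linear_part_def linear_form_scale ideal_mult)

text \<open>The translates of \<open>linear_part J\<close> by the q multiples of \<open>v\<close>
  are disjoint and all lie in the new linear part. So adjoining a new linear form removes at least
  one variable.\<close>

lemma card_linear_part_adjoin:
  fixes J :: "('n::finite, 'a::{finite,field}) mvpoly set"
  assumes J: "is_ideal J" and v: "v \<notin> linear_part J"
  shows "CARD('a) * card (linear_part J) \<le> card (linear_part (adjoin J (linear_form v)))"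
proof -
  let ?f = "\<lambda>(c, u). c *s v + u"
  have "inj_on ?f (UNIV \<times> linear_part J)"
  proof (rule inj_onI, clarify)
    fix c c' u u' assume u: "u \<in> linear_part J" "u' \<in> linear_part J"
      and eq: "c *s v + u = c' *s v + u'"
    have "(c - c') *s v = u' + (-1) *s u"
      using eq by (simp add: vec_eq_iff algebra_simps)
    then have *: "(c - c') *s v \<in> linear_part J"
      using u J by (simp only: linear_part_add linear_part_scale)
    have "c = c'"
    proof (rule ccontr)
      assume "c \<noteq> c'"
      then have "v = inverse (c - c') *s ((c - c') *s v)"
        by (simp only: vector_smult_assoc left_inverse right_minus_eq not_False_eq_True vector_smult_lid)
      then show False using v linear_part_scale[OF J *] by metis
    qed
    then show "c = c' \<and> u = u'" using eq by simp
  qed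
  moreover have "?f ` (UNIV \<times> linear_part J) \<subseteq> linear_part (adjoin J (linear_form v))"
  proof clarify
    fix c u assume "u \<in> linear_part J"
    then have "u \<in> linear_part (adjoin J (linear_form v))"
      using linear_part_mono[OF subset_adjoin] by blast
    moreover have "v \<in> linear_part (adjoin J (linear_form v))"
      by (simp add: linear_part_def mem_adjoin J)
    ultimately show "c *s v + u \<in> linear_part (adjoin J (linear_form v))"
      by (intro linear_part_add linear_part_scale is_ideal_adjoin J)
  qed
  ultimately have "card (UNIV \<times> linear_part J :: ('a \<times> _) set)
      \<le> card (linear_part (adjoin J (linear_form v)))"
    by (intro card_inj_on_le) auto
  then show ?thesis by (simp add: card_cartesian_product)
qed

lemma mvpoly_expand:
  "p = (\<Sum>\<alpha>\<in>Poly_Mapping.keys p. Poly_Mapping.single \<alpha> (Poly_Mapping.lookup p \<alpha>))"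
  by (rule poly_mapping_eqI) (auto simp: lookup_sum lookup_single when_def in_keys_iff)

text \<open>All variables, hence all nonconstant monomials, lie in \<open>J\<close>. Every
  polynomial is then congruent to its constant term, which leaves at most q cosets.\<close>

lemma colength_le_1:
  fixes J :: "('n::finite, 'a::{finite,field}) mvpoly set"
  assumes J: "is_ideal J" and L: "linear_part J = UNIV"
  shows "colength J \<le> 1"
proof -
  have var: "mv_var i \<in> J" for i
    using L linear_form_axis[of i] unfolding linear_part_def by (metis UNIV_I mem_Collect_eq)
  have mon: "Poly_Mapping.single \<alpha> c \<in> J" if nz: "\<alpha> \<noteq> 0" for \<alpha> :: "'n \<Rightarrow>\<^sub>0 nat" and c
  proof -
    obtain i where i: "Poly_Mapping.lookup \<alpha> i \<noteq> 0"
      using nz poly_mapping_eqI[of \<alpha> 0] by auto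
    have "\<alpha> = (\<alpha> - Poly_Mapping.single i 1) + Poly_Mapping.single i 1"
      using i by (intro poly_mapping_eqI) (auto simp: lookup_add lookup_minus lookup_single when_def)
    then have "Poly_Mapping.single \<alpha> c = Poly_Mapping.single (\<alpha> - Poly_Mapping.single i 1) c * mv_var i"
      by (simp add: mv_var_def mult_single)
    then show ?thesis using ideal_mult[OF J var] by metis
  qed
  have "f - mv_const (Poly_Mapping.lookup f 0) \<in> J" for f
  proof -
    let ?t = "\<lambda>\<alpha>. Poly_Mapping.single \<alpha> (Poly_Mapping.lookup f \<alpha>)"
    have "f = (\<Sum>\<alpha>\<in>insert 0 (Poly_Mapping.keys f). ?t \<alpha>)"
      using mvpoly_expand[of f]
      by (subst sum.insert_if) (auto simp: in_keys_iff)
    also have "\<dots> = ?t 0 + (\<Sum>\<alpha>\<in>Poly_Mapping.keys f - {0}. ?t \<alpha>)"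
      by (subst sum.insert_remove) auto
    finally have "f - mv_const (Poly_Mapping.lookup f 0) = (\<Sum>\<alpha>\<in>Poly_Mapping.keys f - {0}. ?t \<alpha>)"
      by (simp add: mv_const_def algebra_simps)
    also have "\<dots> \<in> J" by (intro ideal_sum J mon) auto
    finally show ?thesis .
  qed
  then have sub: "range (coset_rep J) \<subseteq> range (\<lambda>c. coset_rep J (mv_const c))"
    using coset_rep_eq_iff[OF J] by blast
  then have "ideal_index J \<le> card (range (\<lambda>c::'a. coset_rep J (mv_const c)))"
    unfolding ideal_index_def by (intro card_mono) auto
  also have "\<dots> \<le> CARD('a)" by (rule card_image_le) simp
  finally have le: "ideal_index J \<le> CARD('a)" .
  have "finite_index J"
    unfolding finite_index_def by (rule finite_subset[OF sub]) simp
  then show ?thesis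
    using le ideal_index_pos[of J] card_field_ge_2[where 'a='a] by (simp add: colength_def)
qed

text \<open>Nilpotency of the linear forms modulo \<open>J\<close> is what bounds \<open>colength J\<close> in terms of \<open>q\<close>.\<close>

definition admissible :: "('n::finite, 'a::{finite,field}) mvpoly set \<Rightarrow> bool"
  where "admissible J \<longleftrightarrow>
    is_ideal J \<and> finite_index J \<and> (\<forall>v. linear_form v ^ CARD('a) \<in> J)"

lemma admissible_mono: "admissible J \<Longrightarrow> is_ideal K \<Longrightarrow> J \<subseteq> K \<Longrightarrow> admissible K"
  by (auto simp: admissible_def intro: finite_index_mono)

lemma admissible_adjoin: "admissible J \<Longrightarrow> admissible (adjoin J g)"
  by (rule admissible_mono) (auto simp: admissible_def is_ideal_adjoin intro: subsetD[OF subset_adjoin])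

lemma admissible_colon: "admissible J \<Longrightarrow> admissible (colon J g)"
  by (rule admissible_mono)
    (auto simp: admissible_def is_ideal_colon intro: subsetD[OF subset_colon])

lemma admissible_colength_mono:
  "admissible J \<Longrightarrow> is_ideal K \<Longrightarrow> J \<subseteq> K \<Longrightarrow> colength K \<le> colength J"
  by (rule colength_mono) (auto simp: admissible_def)

text \<open>Adjoining a linear form outside \<open>J\<close> divides the colength by at most q,
  since its q-th power lies in \<open>J\<close>, and multiplies the size of the linear part by at
  least q. The product thus never decreases until all linear forms are included, where the colength
  is at most 1.\<close>

lemma colength_linear_part_le:
  fixes J :: "('n::finite, 'a::{finite,field}) mvpoly set"
  assumes "admissible J"
  shows "colength J * real (card (linear_part J)) \<le> real CARD('a ^ 'n)"
  using assms
proof (induction "CARD('a ^ 'n) - card (linear_part J)" arbitrary: J rule: less_induct)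
  case less
  have J: "is_ideal J" "finite_index J" using less.prems by (auto simp: admissible_def)
  show ?case
  proof (cases "linear_part J = UNIV")
    case True
    then show ?thesis using colength_le_1[OF J(1) True]
      by (simp add: mult_left_le_one_le colength_nonneg[OF J(2)])
  next
    case False
    then obtain v where v: "v \<notin> linear_part J" by blast
    let ?K = "adjoin J (linear_form v)"
    note c = card_linear_part_adjoin[OF J(1) v]
    have K: "admissible ?K" by (rule admissible_adjoin[OF less.prems])
    have "card (linear_part J) > 0"
      using zero_in_linear_part[OF J(1)] by (auto simp: card_gt_0_iff)
    then have "card (linear_part J) < CARD('a) * card (linear_part J)"
      using card_field_ge_2[where 'a='a] by simp
    moreover have "card (linear_part ?K) \<le> CARD('a ^ 'n)" by (rule card_mono) auto
    ultimately have "CARD('a ^ 'n) - card (linear_part ?K) < CARD('a ^ 'n) - card (linear_part J)"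
      using c by linarith
    from less.hyps[OF this K]
    have IH: "colength ?K * real (card (linear_part ?K)) \<le> real CARD('a ^ 'n)" .
    have "colength J \<le> real CARD('a) * colength ?K"
      using less.prems by (intro colength_le_power J) (auto simp: admissible_def)
    then have "colength J * real (card (linear_part J))
        \<le> (real CARD('a) * colength ?K) * real (card (linear_part J))"
      by (rule mult_right_mono) simp
    also have "\<dots> = colength ?K * real (CARD('a) * card (linear_part J))" by simp
    also have "\<dots> \<le> colength ?K * real (card (linear_part ?K))"
      using K by (intro mult_left_mono of_nat_mono c colength_nonneg) (auto simp: admissible_def)
    finally show ?thesis using IH by linarith
  qed
qed

section \<open>Ideals of top-degree forms\<close>

definition mdeg :: "('n::finite \<Rightarrow>\<^sub>0 nat) \<Rightarrow> nat"
  where "mdeg \<alpha> = (\<Sum>i\<in>UNIV. Poly_Mapping.lookup \<alpha> i)"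

lemma mdeg_add: "mdeg (\<alpha> + \<beta>) = mdeg \<alpha> + mdeg \<beta>"
  by (simp add: mdeg_def lookup_add sum.distrib)

lemma mdeg_zero [simp]: "mdeg 0 = 0"
  by (simp add: mdeg_def)

lemma mdeg_single: "mdeg (Poly_Mapping.single i k) = k"
  by (simp add: mdeg_def lookup_single when_def)

lemma finite_mdeg_le: "finite {\<alpha> :: 'n::finite \<Rightarrow>\<^sub>0 nat. mdeg \<alpha> \<le> d}"
proof (rule finite_imageD)
  have "Poly_Mapping.lookup \<alpha> i \<le> d" if "mdeg \<alpha> \<le> d" for \<alpha> :: "'n \<Rightarrow>\<^sub>0 nat" and i
    using that member_le_sum[of i UNIV "Poly_Mapping.lookup \<alpha>"] by (simp add: mdeg_def)
  then have "Poly_Mapping.lookup ` {\<alpha> :: 'n \<Rightarrow>\<^sub>0 nat. mdeg \<alpha> \<le> d} \<subseteq> PiE UNIV (\<lambda>_. {..d})"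
    by auto
  then show "finite (Poly_Mapping.lookup ` {\<alpha> :: 'n \<Rightarrow>\<^sub>0 nat. mdeg \<alpha> \<le> d})"
    by (rule finite_subset) (simp add: finite_PiE)
  show "inj_on Poly_Mapping.lookup {\<alpha> :: 'n \<Rightarrow>\<^sub>0 nat. mdeg \<alpha> \<le> d}"
    by (auto intro: inj_onI poly_mapping_eqI)
qed

text \<open>Order by degree, break ties by an injective code, and number each exponent vector by how
  many precede it. That number is finite because only finitely many vectors have bounded
  degree.\<close>

lemma degree_compatible_enumeration:
  "\<exists>\<kappa> :: ('n::finite \<Rightarrow>\<^sub>0 nat) \<Rightarrow> nat. inj \<kappa> \<and> (\<forall>\<alpha> \<beta>. mdeg \<alpha> < mdeg \<beta> \<longrightarrow> \<kappa> \<alpha> < \<kappa> \<beta>)"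
proof -
  \<comment> \<open>Functions from a finite type to the naturals are countable, so
    \<open>to_nat\<close> is injective on them.\<close>
  define e :: "('n \<Rightarrow>\<^sub>0 nat) \<Rightarrow> nat" where "e \<alpha> = to_nat (Poly_Mapping.lookup \<alpha>)" for \<alpha>
  have e: "\<alpha> = \<beta>" if "e \<alpha> = e \<beta>" for \<alpha> \<beta>
    using that by (simp add: e_def lookup_inject)
  define below where "below \<alpha> \<beta> \<longleftrightarrow> mdeg \<alpha> < mdeg \<beta> \<or> mdeg \<alpha> = mdeg \<beta> \<and> e \<alpha> < e \<beta>" for \<alpha> \<beta>
  have less: "card {\<gamma>. below \<gamma> \<alpha>} < card {\<gamma>. below \<gamma> \<beta>}" if "below \<alpha> \<beta>" for \<alpha> \<beta>
  proof (rule psubset_card_mono)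
    show "finite {\<gamma>. below \<gamma> \<beta>}"
      by (rule finite_subset[OF _ finite_mdeg_le[of "mdeg \<beta>"]]) (auto simp: below_def)
    show "{\<gamma>. below \<gamma> \<alpha>} \<subset> {\<gamma>. below \<gamma> \<beta>}"
      using that by (auto simp: below_def)
  qed
  have "\<alpha> = \<beta>" if eq: "card {\<gamma>. below \<gamma> \<alpha>} = card {\<gamma>. below \<gamma> \<beta>}" for \<alpha> \<beta>
  proof -
    have "\<not> below \<alpha> \<beta>" "\<not> below \<beta> \<alpha>" using eq less by force+
    then have "e \<alpha> = e \<beta>" by (auto simp: below_def)
    then show ?thesis by (rule e)
  qed
  then have "inj (\<lambda>\<alpha>. card {\<gamma>. below \<gamma> \<alpha>})" by (rule injI)
  moreover have "\<forall>\<alpha> \<beta>. mdeg \<alpha> < mdeg \<beta> \<longrightarrow> card {\<gamma>. below \<gamma> \<alpha>} < card {\<gamma>. below \<gamma> \<beta>}"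
    using less by (simp add: below_def)
  ultimately show ?thesis by blast
qed

text \<open>
  The enumeration \<open>\<kappa>\<close> need not be a monomial order: only compatibility with the degree is used, so
  that an ideal and its ideal of top-degree forms have the same leading monomials.
\<close>

definition leading_monomials ::
    "(('n::finite \<Rightarrow>\<^sub>0 nat) \<Rightarrow> nat) \<Rightarrow> ('n, 'a::{finite,field}) mvpoly set \<Rightarrow> ('n \<Rightarrow>\<^sub>0 nat) set"
  where "leading_monomials \<kappa> K =
    {\<alpha>. \<exists>f\<in>K. \<alpha> \<in> Poly_Mapping.keys f \<and> (\<forall>\<beta>\<in>Poly_Mapping.keys f. \<kappa> \<beta> \<le> \<kappa> \<alpha>)}"

lemma lookup_single_times:
  "Poly_Mapping.lookup (Poly_Mapping.single \<beta> c * f) \<gamma> =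
    (\<Sum>\<alpha>\<in>Poly_Mapping.keys f. c * Poly_Mapping.lookup f \<alpha> when \<beta> + \<alpha> = \<gamma>)"
  for f :: "('n::finite, 'a::comm_semiring_1) mvpoly"
proof -
  have "Poly_Mapping.single \<beta> c * f =
      (\<Sum>\<alpha>\<in>Poly_Mapping.keys f. Poly_Mapping.single \<beta> c * Poly_Mapping.single \<alpha> (Poly_Mapping.lookup f \<alpha>))"
    by (subst mvpoly_expand[of f]) (simp add: sum_distrib_left)
  then show ?thesis by (simp add: mult_single lookup_sum lookup_single)
qed

lemma lookup_single_times_shift:
  "Poly_Mapping.lookup (Poly_Mapping.single \<beta> c * f) (\<beta> + \<alpha>) = c * Poly_Mapping.lookup f \<alpha>"
  for f :: "('n::finite, 'a::comm_semiring_1) mvpoly"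
  unfolding lookup_single_times by (auto simp: when_def in_keys_iff)

lemma lookup_single_times_eq_0:
  "(\<And>\<alpha>. \<gamma> \<noteq> \<beta> + \<alpha>) \<Longrightarrow> Poly_Mapping.lookup (Poly_Mapping.single \<beta> c * f) \<gamma> = 0"
  for f :: "('n::finite, 'a::comm_semiring_1) mvpoly"
  unfolding lookup_single_times by (rule sum.neutral) (auto simp: when_def)

lemma lookup_const_times: "Poly_Mapping.lookup (mv_const c * f) \<alpha> = c * Poly_Mapping.lookup f \<alpha>"
  for f :: "('n::finite, 'a::comm_semiring_1) mvpoly"
  using lookup_single_times_shift[of 0 c f \<alpha>] by (simp add: mv_const_def)

text \<open>Existence is a division algorithm, by induction on a bound for \<open>\<kappa>\<close>
  on the monomials of \<open>f\<close>. It subtracts only scalar multiples of elements of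
  \<open>K\<close>, so \<open>\<kappa>\<close> need not respect products. Uniqueness holds because a
  nonzero difference in \<open>K\<close> would have its leading monomial among the excluded
  ones.\<close>

lemma nonleading_transversal:
  fixes K :: "('n::finite, 'a::{finite,field}) mvpoly set"
  assumes K: "is_ideal K" and \<kappa>: "inj \<kappa>"
  shows "bij_betw (coset_rep K) {f. Poly_Mapping.keys f \<inter> leading_monomials \<kappa> K = {}}
    (range (coset_rep K))"
proof (rule transversal_bij_betw[OF K])
  let ?C = "{f :: ('n, 'a) mvpoly. Poly_Mapping.keys f \<inter> leading_monomials \<kappa> K = {}}"
  have "\<exists>c\<in>?C. f - c \<in> K" if "\<forall>\<beta>\<in>Poly_Mapping.keys f. \<kappa> \<beta> < b" for b and f :: "('n, 'a) mvpoly"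
    using that
  proof (induction b arbitrary: f)
    case 0
    then have "f = 0" by (metis all_not_in_conv keys_eq_empty not_less0)
    then show ?case by (intro bexI[of _ 0]) (auto simp: ideal_zero[OF K])
  next
    case (Suc b)
    show ?case
    proof (cases "\<exists>\<alpha>\<in>Poly_Mapping.keys f. \<kappa> \<alpha> = b")
      case False
      then have "\<forall>\<beta>\<in>Poly_Mapping.keys f. \<kappa> \<beta> < b" using Suc.prems by (metis less_SucE)
      then show ?thesis by (rule Suc.IH)
    next
      case True
      then obtain \<alpha> where \<alpha>: "\<alpha> \<in> Poly_Mapping.keys f" "\<kappa> \<alpha> = b" by blast
      \<comment> \<open>Shared by both cases: by injectivity of \<open>\<kappa>\<close>,
        \<open>\<alpha>\<close> is the only monomial at level \<open>b\<close>, so cancelling its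
        coefficient lowers the bound.\<close>
      have below: "\<forall>\<beta>\<in>Poly_Mapping.keys (f - g). \<kappa> \<beta> < b"
        if "\<forall>\<beta>\<in>Poly_Mapping.keys g. \<kappa> \<beta> \<le> b"
          "Poly_Mapping.lookup g \<alpha> = Poly_Mapping.lookup f \<alpha>" for g
      proof
        fix \<beta> assume \<beta>: "\<beta> \<in> Poly_Mapping.keys (f - g)"
        then have "\<beta> \<noteq> \<alpha>" using that(2) by (auto simp: in_keys_iff lookup_minus)
        then have "\<kappa> \<beta> \<noteq> b" using \<alpha>(2) injD[OF \<kappa>] by metis
        moreover have "\<beta> \<in> Poly_Mapping.keys f \<or> \<beta> \<in> Poly_Mapping.keys g"
          using \<beta> by (auto simp: in_keys_iff lookup_minus)
        then have "\<kappa> \<beta> \<le> b" using Suc.prems that(1) by (metis less_Suc_eq_le)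
        ultimately show "\<kappa> \<beta> < b" by simp
      qed
      show ?thesis
      proof (cases "\<alpha> \<in> leading_monomials \<kappa> K")
        case True
        then obtain g where g: "g \<in> K" "\<alpha> \<in> Poly_Mapping.keys g"
          "\<forall>\<beta>\<in>Poly_Mapping.keys g. \<kappa> \<beta> \<le> b"
          using \<alpha>(2) by (auto simp: leading_monomials_def)
        define g' where "g' = mv_const (Poly_Mapping.lookup f \<alpha> / Poly_Mapping.lookup g \<alpha>) * g"
        have "\<forall>\<beta>\<in>Poly_Mapping.keys g'. \<kappa> \<beta> \<le> b"
          using g(3) by (auto simp: g'_def in_keys_iff lookup_const_times)
        moreover have "Poly_Mapping.lookup g' \<alpha> = Poly_Mapping.lookup f \<alpha>"
          using g(2) by (simp add: g'_def lookup_const_times in_keys_iff)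
        ultimately obtain c where c: "c \<in> ?C" "(f - g') - c \<in> K"
          using Suc.IH[OF below] by blast
        have "g' \<in> K" unfolding g'_def by (rule ideal_mult[OF K g(1)])
        then have "((f - g') - c) + g' \<in> K" by (rule ideal_add[OF K c(2)])
        then show ?thesis using c(1) by (intro bexI[of _ c]) simp_all
      next
        case False
        \<comment> \<open>A nonleading top term cannot be cancelled by \<open>K\<close>; it is set
          aside and restored in the remainder \<open>c + g\<close>.\<close>
        define g where "g = Poly_Mapping.single \<alpha> (Poly_Mapping.lookup f \<alpha>)"
        have "\<forall>\<beta>\<in>Poly_Mapping.keys g. \<kappa> \<beta> \<le> b" "Poly_Mapping.lookup g \<alpha> = Poly_Mapping.lookup f \<alpha>"
          using \<alpha>(2) by (auto simp: g_def)
        then obtain c where c: "c \<in> ?C" "(f - g) - c \<in> K"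
          using Suc.IH[OF below] by blast
        have "Poly_Mapping.keys (c + g) \<subseteq> Poly_Mapping.keys c \<union> {\<alpha>}"
          using Poly_Mapping.keys_add[of c g] by (auto simp: g_def split: if_splits)
        then have "c + g \<in> ?C" using c(1) False by blast
        moreover have "f - (c + g) \<in> K" using c(2) by (simp add: algebra_simps)
        ultimately show ?thesis by blast
      qed
    qed
  qed
  moreover have "\<exists>b. \<forall>\<beta>\<in>Poly_Mapping.keys f. \<kappa> \<beta> < b" for f :: "('n, 'a) mvpoly"
  proof -
    have "\<forall>\<beta>\<in>Poly_Mapping.keys f. \<kappa> \<beta> < Suc (Max (\<kappa> ` Poly_Mapping.keys f))"
      by (simp add: le_imp_less_Suc)
    then show ?thesis by blast
  qed
  ultimately show "\<exists>c\<in>?C. f - c \<in> K" for f by blast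
next
  fix c c'
  assume c: "c \<in> {f. Poly_Mapping.keys f \<inter> leading_monomials \<kappa> K = {}}"
    "c' \<in> {f. Poly_Mapping.keys f \<inter> leading_monomials \<kappa> K = {}}" "c - c' \<in> K"
  show "c = c'"
  proof (rule ccontr)
    assume "c \<noteq> c'"
    then have ne: "Poly_Mapping.keys (c - c') \<noteq> {}" by simp
    have "Max (\<kappa> ` Poly_Mapping.keys (c - c')) \<in> \<kappa> ` Poly_Mapping.keys (c - c')"
      by (rule Max_in) (use ne in auto)
    then obtain \<alpha> where \<alpha>: "\<alpha> \<in> Poly_Mapping.keys (c - c')"
        "\<kappa> \<alpha> = Max (\<kappa> ` Poly_Mapping.keys (c - c'))" by auto
    then have "\<alpha> \<in> leading_monomials \<kappa> K"
      using c(3) by (auto simp: leading_monomials_def)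
    moreover have "\<alpha> \<in> Poly_Mapping.keys c \<union> Poly_Mapping.keys c'"
      using \<alpha>(1) by (auto simp: in_keys_iff lookup_minus)
    ultimately show False using c(1,2) by blast
  qed
qed

text \<open>The ideal spanned by the top-degree forms of the elements of \<open>I\<close>, described degree by degree.\<close>

definition initial_ideal :: "('n::finite, 'a::{finite,field}) mvpoly set \<Rightarrow> ('n, 'a) mvpoly set"
  where "initial_ideal I = {f. \<forall>i. \<exists>g\<in>I. (\<forall>\<alpha>\<in>Poly_Mapping.keys g. mdeg \<alpha> \<le> i) \<and>
    (\<forall>\<alpha>. mdeg \<alpha> = i \<longrightarrow> Poly_Mapping.lookup g \<alpha> = Poly_Mapping.lookup f \<alpha>)}"

lemma initial_ideal_mono: "I \<subseteq> I' \<Longrightarrow> initial_ideal I \<subseteq> initial_ideal I'"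
  unfolding initial_ideal_def by blast

text \<open>Criterion for a homogeneous \<open>f\<close>: only degree \<open>i\<close> carries
  content, and in every other degree the witness is 0.\<close>

lemma initial_idealI:
  assumes "is_ideal I" "g \<in> I" "\<forall>\<alpha>\<in>Poly_Mapping.keys g. mdeg \<alpha> \<le> i"
    and "\<And>\<alpha>. Poly_Mapping.lookup f \<alpha> = (if mdeg \<alpha> = i then Poly_Mapping.lookup g \<alpha> else 0)"
  shows "f \<in> initial_ideal I"
  unfolding initial_ideal_def
proof (intro CollectI allI)
  fix i'
  show "\<exists>g\<in>I. (\<forall>\<alpha>\<in>Poly_Mapping.keys g. mdeg \<alpha> \<le> i') \<and>
    (\<forall>\<alpha>. mdeg \<alpha> = i' \<longrightarrow> Poly_Mapping.lookup g \<alpha> = Poly_Mapping.lookup f \<alpha>)"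
  proof (cases "i' = i")
    case True
    then show ?thesis using assms by (intro bexI[of _ g]) auto
  next
    case False
    then show ?thesis using assms(4) ideal_zero[OF assms(1)] by (intro bexI[of _ 0]) auto
  qed
qed

lemma initial_idealE:
  assumes "f \<in> initial_ideal I"
  obtains g where "g \<in> I" "\<And>\<alpha>. \<alpha> \<in> Poly_Mapping.keys g \<Longrightarrow> mdeg \<alpha> \<le> i"
    "\<And>\<alpha>. mdeg \<alpha> = i \<Longrightarrow> Poly_Mapping.lookup g \<alpha> = Poly_Mapping.lookup f \<alpha>"
  using assms unfolding initial_ideal_def by blast

lemma initial_ideal_add:
  assumes I: "is_ideal I" and "f \<in> initial_ideal I" "f' \<in> initial_ideal I"
  shows "f + f' \<in> initial_ideal I"
  unfolding initial_ideal_def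
proof (intro CollectI allI)
  fix i
  obtain g where g: "g \<in> I" "\<And>\<alpha>. \<alpha> \<in> Poly_Mapping.keys g \<Longrightarrow> mdeg \<alpha> \<le> i"
    "\<And>\<alpha>. mdeg \<alpha> = i \<Longrightarrow> Poly_Mapping.lookup g \<alpha> = Poly_Mapping.lookup f \<alpha>"
    using initial_idealE[OF assms(2)] by blast
  obtain g' where g': "g' \<in> I" "\<And>\<alpha>. \<alpha> \<in> Poly_Mapping.keys g' \<Longrightarrow> mdeg \<alpha> \<le> i"
    "\<And>\<alpha>. mdeg \<alpha> = i \<Longrightarrow> Poly_Mapping.lookup g' \<alpha> = Poly_Mapping.lookup f' \<alpha>"
    using initial_idealE[OF assms(3)] by blast
  have "\<forall>\<alpha>\<in>Poly_Mapping.keys (g + g'). mdeg \<alpha> \<le> i"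
    using Poly_Mapping.keys_add[of g g'] g(2) g'(2) by blast
  then show "\<exists>g\<in>I. (\<forall>\<alpha>\<in>Poly_Mapping.keys g. mdeg \<alpha> \<le> i) \<and>
    (\<forall>\<alpha>. mdeg \<alpha> = i \<longrightarrow> Poly_Mapping.lookup g \<alpha> = Poly_Mapping.lookup (f + f') \<alpha>)"
    using g(3) g'(3) ideal_add[OF I g(1) g'(1)]
    by (intro bexI[of _ "g + g'"]) (simp_all add: lookup_add)
qed

text \<open>A monomial factor shifts degrees: the witness in degree \<open>i\<close> is the multiple
  of the witness for \<open>f\<close> in degree \<open>i - mdeg \<beta>\<close>, or 0 if that
  difference would be negative.\<close>

lemma initial_ideal_single_times:
  assumes I: "is_ideal I" and f: "f \<in> initial_ideal I"
  shows "Poly_Mapping.single \<beta> c * f \<in> initial_ideal I"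
  unfolding initial_ideal_def
proof (intro CollectI allI)
  fix i
  let ?s = "Poly_Mapping.single \<beta> c"
  show "\<exists>g\<in>I. (\<forall>\<alpha>\<in>Poly_Mapping.keys g. mdeg \<alpha> \<le> i) \<and>
    (\<forall>\<alpha>. mdeg \<alpha> = i \<longrightarrow> Poly_Mapping.lookup g \<alpha> = Poly_Mapping.lookup (?s * f) \<alpha>)"
  proof (cases "mdeg \<beta> \<le> i")
    case False
    then have "Poly_Mapping.lookup (?s * f) \<alpha> = 0" if "mdeg \<alpha> = i" for \<alpha>
      using that by (intro lookup_single_times_eq_0) (auto simp: mdeg_add)
    then show ?thesis using ideal_zero[OF I] by (intro bexI[of _ 0]) auto
  next
    case True
    obtain g where g: "g \<in> I" "\<And>\<alpha>. \<alpha> \<in> Poly_Mapping.keys g \<Longrightarrow> mdeg \<alpha> \<le> i - mdeg \<beta>"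
      "\<And>\<alpha>. mdeg \<alpha> = i - mdeg \<beta> \<Longrightarrow> Poly_Mapping.lookup g \<alpha> = Poly_Mapping.lookup f \<alpha>"
      using initial_idealE[OF f] by blast
    have "mdeg \<gamma> \<le> i" if \<gamma>: "\<gamma> \<in> Poly_Mapping.keys (?s * g)" for \<gamma>
    proof -
      obtain \<alpha> where \<alpha>: "\<gamma> = \<beta> + \<alpha>"
        using \<gamma> lookup_single_times_eq_0[of \<gamma> \<beta> c g] by (auto simp: in_keys_iff)
      then have "\<alpha> \<in> Poly_Mapping.keys g"
        using \<gamma> lookup_single_times_shift[of \<beta> c g \<alpha>] by (auto simp: in_keys_iff)
      then show ?thesis using g(2)[of \<alpha>] \<alpha> True by (simp add: mdeg_add)
    qed
    moreover have "Poly_Mapping.lookup (?s * g) \<gamma> = Poly_Mapping.lookup (?s * f) \<gamma>"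
      if "mdeg \<gamma> = i" for \<gamma>
    proof (cases "\<exists>\<alpha>. \<gamma> = \<beta> + \<alpha>")
      case True
      then obtain \<alpha> where \<alpha>: "\<gamma> = \<beta> + \<alpha>" by blast
      then show ?thesis
        using that g(3)[of \<alpha>] by (simp add: lookup_single_times_shift mdeg_add)
    qed (simp add: lookup_single_times_eq_0)
    ultimately show ?thesis
      using ideal_mult[OF I g(1)] by (intro bexI[of _ "?s * g"]) auto
  qed
qed

lemma is_ideal_initial_ideal:
  assumes I: "is_ideal I" shows "is_ideal (initial_ideal I)"
proof -
  have zero: "0 \<in> initial_ideal I"
    by (rule initial_idealI[OF I ideal_zero[OF I], of 0]) auto
  have "r * f \<in> initial_ideal I" if "f \<in> initial_ideal I" for r f
  proof -
    have "(\<Sum>\<alpha>\<in>A. Poly_Mapping.single \<alpha> (Poly_Mapping.lookup r \<alpha>) * f) \<in> initial_ideal I" for A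
      by (induction A rule: infinite_finite_induct)
        (auto intro: zero initial_ideal_add[OF I] initial_ideal_single_times[OF I that])
    then show ?thesis
      by (subst mvpoly_expand[of r]) (simp add: sum_distrib_right)
  qed
  then show ?thesis
    using zero initial_ideal_add[OF I] by (auto simp: is_ideal_def)
qed

text \<open>Since \<open>\<kappa>\<close> refines the degree, a leading monomial is visible in the
  top-degree form alone. Terms of lower degree can be added or dropped without changing it.\<close>

lemma leading_monomials_initial_ideal:
  assumes I: "is_ideal I" and \<kappa>: "\<And>\<alpha> \<beta>. mdeg \<alpha> < mdeg \<beta> \<Longrightarrow> \<kappa> \<alpha> < \<kappa> \<beta>"
  shows "leading_monomials \<kappa> (initial_ideal I) = leading_monomials \<kappa> I"
proof (intro equalityI subsetI)
  fix \<alpha> assume "\<alpha> \<in> leading_monomials \<kappa> (initial_ideal I)"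
  then obtain f where f: "f \<in> initial_ideal I" "\<alpha> \<in> Poly_Mapping.keys f"
    "\<And>\<beta>. \<beta> \<in> Poly_Mapping.keys f \<Longrightarrow> \<kappa> \<beta> \<le> \<kappa> \<alpha>"
    by (auto simp: leading_monomials_def)
  obtain g where g: "g \<in> I" "\<And>\<beta>. \<beta> \<in> Poly_Mapping.keys g \<Longrightarrow> mdeg \<beta> \<le> mdeg \<alpha>"
    "\<And>\<beta>. mdeg \<beta> = mdeg \<alpha> \<Longrightarrow> Poly_Mapping.lookup g \<beta> = Poly_Mapping.lookup f \<beta>"
    using initial_idealE[OF f(1)] by blast
  have "\<kappa> \<beta> \<le> \<kappa> \<alpha>" if "\<beta> \<in> Poly_Mapping.keys g" for \<beta>
  proof (cases "mdeg \<beta> = mdeg \<alpha>")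
    case True
    then show ?thesis using that g(3) f(3) by (auto simp: in_keys_iff)
  next
    case False
    then show ?thesis using g(2)[OF that] \<kappa>[of \<beta> \<alpha>] by simp
  qed
  moreover have "\<alpha> \<in> Poly_Mapping.keys g" using f(2) g(3)[of \<alpha>] by (simp add: in_keys_iff)
  ultimately show "\<alpha> \<in> leading_monomials \<kappa> I"
    using g(1) by (auto simp: leading_monomials_def)
next
  fix \<alpha> assume "\<alpha> \<in> leading_monomials \<kappa> I"
  then obtain g where g: "g \<in> I" "\<alpha> \<in> Poly_Mapping.keys g"
    "\<And>\<beta>. \<beta> \<in> Poly_Mapping.keys g \<Longrightarrow> \<kappa> \<beta> \<le> \<kappa> \<alpha>"
    by (auto simp: leading_monomials_def)
  have deg: "\<forall>\<beta>\<in>Poly_Mapping.keys g. mdeg \<beta> \<le> mdeg \<alpha>"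
    using g(3) \<kappa> by (meson leD not_le)
  define f where "f = (\<Sum>\<beta>\<in>{\<beta>\<in>Poly_Mapping.keys g. mdeg \<beta> = mdeg \<alpha>}.
      Poly_Mapping.single \<beta> (Poly_Mapping.lookup g \<beta>))"
  have f: "Poly_Mapping.lookup f \<beta> = (if mdeg \<beta> = mdeg \<alpha> then Poly_Mapping.lookup g \<beta> else 0)" for \<beta>
    by (auto simp: f_def lookup_sum lookup_single when_def in_keys_iff)
  have "f \<in> initial_ideal I" by (rule initial_idealI[OF I g(1) deg f])
  moreover have "\<alpha> \<in> Poly_Mapping.keys f" using g(2) f by (simp add: in_keys_iff)
  moreover have "\<forall>\<beta>\<in>Poly_Mapping.keys f. \<kappa> \<beta> \<le> \<kappa> \<alpha>"
    using g(3) f by (auto simp: in_keys_iff split: if_splits)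
  ultimately show "\<alpha> \<in> leading_monomials \<kappa> (initial_ideal I)"
    by (auto simp: leading_monomials_def)
qed

text \<open>The polynomials without leading monomials are a transversal for both ideals, because the
  two have the same leading monomials.\<close>

lemma initial_ideal_index:
  assumes I: "is_ideal I"
  shows "ideal_index (initial_ideal I) = ideal_index I"
    and "finite_index (initial_ideal I) \<longleftrightarrow> finite_index I"
proof -
  obtain \<kappa> :: "('a \<Rightarrow>\<^sub>0 nat) \<Rightarrow> nat" where \<kappa>: "inj \<kappa>" "\<And>\<alpha> \<beta>. mdeg \<alpha> < mdeg \<beta> \<Longrightarrow> \<kappa> \<alpha> < \<kappa> \<beta>"
    using degree_compatible_enumeration by blast
  let ?C = "{f. Poly_Mapping.keys f \<inter> leading_monomials \<kappa> I = {}}"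
  have "bij_betw (coset_rep I) ?C (range (coset_rep I))"
    by (rule nonleading_transversal[OF I \<kappa>(1)])
  moreover have "bij_betw (coset_rep (initial_ideal I)) ?C (range (coset_rep (initial_ideal I)))"
    using nonleading_transversal[OF is_ideal_initial_ideal[OF I] \<kappa>(1)]
    by (simp only: leading_monomials_initial_ideal[OF I \<kappa>(2)])
  ultimately show "ideal_index (initial_ideal I) = ideal_index I"
    and "finite_index (initial_ideal I) \<longleftrightarrow> finite_index I"
    unfolding ideal_index_def finite_index_def
    by (metis bij_betw_same_card, metis bij_betw_finite)
qed

section \<open>Vanishing ideals\<close>

definition vanishing_ideal :: "('a::{finite,field} ^ 'n::finite) set \<Rightarrow> ('n, 'a) mvpoly set"
  where "vanishing_ideal S = {f. \<forall>x\<in>S. mv_eval f x = 0}"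

lemma is_ideal_vanishing_ideal: "is_ideal (vanishing_ideal S)"
  by (simp add: is_ideal_def vanishing_ideal_def)

lemma mv_eval_diff: "mv_eval (f - g) x = mv_eval f x - mv_eval g x"
  for f g :: "('n::finite, 'a::comm_ring_1) mvpoly"
  using mv_eval_add[of "f - g" g x] by (simp add: algebra_simps)

lemma mv_eval_prod: "mv_eval (\<Prod>a\<in>A. F a) x = (\<Prod>a\<in>A. mv_eval (F a) x)"
  by (induction A rule: infinite_finite_induct) auto

lemma separating_polynomial:
  fixes a b :: "'a::{finite,field} ^ 'n::finite"
  assumes "a \<noteq> b"
  shows "\<exists>p. mv_eval p a = 1 \<and> mv_eval p b = 0"
proof -
  obtain i where i: "a $ i \<noteq> b $ i" using assms by (auto simp: vec_eq_iff)
  show ?thesis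
    using i by (intro exI[of _ "mv_const (inverse (a $ i - b $ i)) * (mv_var i - mv_const (b $ i))"])
      (simp add: mv_eval_diff)
qed

lemma interpolating_polynomial:
  fixes F :: "'a::{finite,field} ^ 'n::finite \<Rightarrow> 'a"
  shows "\<exists>p. \<forall>x. mv_eval p x = F x"
proof -
  obtain s where s: "\<And>a b :: 'a ^ 'n. a \<noteq> b \<Longrightarrow> mv_eval (s a b) a = 1 \<and> mv_eval (s a b) b = 0"
    using separating_polynomial by metis
  have delta: "mv_eval (\<Prod>b\<in>UNIV - {a}. s a b) x = (if x = a then 1 else 0)" for a x
  proof (cases "x = a")
    case False
    then have "\<exists>b\<in>UNIV - {a}. mv_eval (s a b) x = 0" using s[of a x] by auto
    then show ?thesis using False by (simp add: mv_eval_prod)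
  qed (use s in \<open>auto simp: mv_eval_prod intro!: prod.neutral\<close>)
  have "mv_eval (\<Sum>a\<in>UNIV. mv_const (F a) * (\<Prod>b\<in>UNIV - {a}. s a b)) x = F x" for x
    by (simp add: delta if_distrib[of "(*) _"] cong: if_cong)
  then show ?thesis by blast
qed

text \<open>Evaluation identifies the quotient by the vanishing ideal with all functions from
  \<open>S\<close> to the field; interpolation gives surjectivity. Taking logarithms, the colength
  becomes the number of points.\<close>

lemma vanishing_ideal_index:
  fixes S :: "('a::{finite,field} ^ 'n::finite) set"
  shows "finite_index (vanishing_ideal S)"
    and "ideal_index (vanishing_ideal S) = CARD('a) ^ card S"
proof -
  let ?I = "vanishing_ideal S" and ?\<phi> = "\<lambda>f. restrict (mv_eval f) S"
  note I = is_ideal_vanishing_ideal[of S]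
  have iff: "?\<phi> f = ?\<phi> g \<longleftrightarrow> f - g \<in> ?I" for f g
    by (auto simp: vanishing_ideal_def mv_eval_diff restrict_def fun_eq_iff)
  have "bij_betw ?\<phi> (range (coset_rep ?I)) (PiE S (\<lambda>_. UNIV))"
  proof (rule bij_betwI')
    fix f g assume "f \<in> range (coset_rep ?I)" "g \<in> range (coset_rep ?I)"
    then show "?\<phi> f = ?\<phi> g \<longleftrightarrow> f = g"
      using coset_rep_range_inj[OF I] iff by blast
  next
    fix F :: "'a ^ 'n \<Rightarrow> 'a" assume F: "F \<in> PiE S (\<lambda>_. UNIV)"
    obtain p where p: "\<And>x. mv_eval p x = F x" using interpolating_polynomial[of F] by blast
    have "F = ?\<phi> p" using F by (auto simp: p fun_eq_iff PiE_def extensional_def)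
    also have "\<dots> = ?\<phi> (coset_rep ?I p)"
      using iff coset_rep_diff[OF I] by metis
    finally show "\<exists>f\<in>range (coset_rep ?I). F = ?\<phi> f" by blast
  qed simp
  then show "finite_index ?I" "ideal_index ?I = CARD('a) ^ card S"
    unfolding finite_index_def ideal_index_def
    by (simp_all add: bij_betw_finite bij_betw_same_card finite_PiE card_PiE)
qed

lemma colength_initial_vanishing_ideal:
  "finite_index (initial_ideal (vanishing_ideal S))"
  "colength (initial_ideal (vanishing_ideal S)) = real (card S)"
  for S :: "('a::{finite,field} ^ 'n::finite) set"
  using card_field_ge_2[where 'a='a]
  by (simp_all add: colength_def initial_ideal_index is_ideal_vanishing_ideal vanishing_ideal_index
      log_nat_power)

section \<open>Powers of linear forms as top-degree forms\<close>

lemma keys_linear_form: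
  assumes "\<alpha> \<in> Poly_Mapping.keys (linear_form v)"
  shows "mdeg \<alpha> = 1"
proof -
  have "linear_form v = (\<Sum>i\<in>UNIV. Poly_Mapping.single (Poly_Mapping.single i 1) (v $ i))"
    by (simp add: linear_form_def mv_const_def mv_var_def mult_single)
  then have "\<alpha> \<in> (\<Union>i. Poly_Mapping.keys (Poly_Mapping.single (Poly_Mapping.single i (1::nat)) (v $ i)))"
    using assms
      Poly_Mapping.keys_sum[of "\<lambda>i. Poly_Mapping.single (Poly_Mapping.single i (1::nat)) (v $ i)" UNIV]
    by auto
  then show ?thesis by (auto simp: mdeg_single split: if_splits)
qed

lemma keys_linear_form_power:
  "\<alpha> \<in> Poly_Mapping.keys (linear_form v ^ d) \<Longrightarrow> mdeg \<alpha> = d"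
proof (induction d arbitrary: \<alpha>)
  case 0
  then show ?case by (simp split: if_splits)
next
  case (Suc d)
  have "\<alpha> \<in> Poly_Mapping.keys (linear_form v * linear_form v ^ d)"
    using Suc.prems by simp
  then obtain \<beta> \<gamma> where *: "\<alpha> = \<beta> + \<gamma>" "\<beta> \<in> Poly_Mapping.keys (linear_form v)"
    "\<gamma> \<in> Poly_Mapping.keys (linear_form v ^ d)"
    using Poly_Mapping.keys_mult[of "linear_form v" "linear_form v ^ d"] by blast
  then show ?case using Suc.IH[OF *(3)] keys_linear_form[OF *(2)] by (simp add: mdeg_add)
qed

text \<open>The power of a linear form is homogeneous of degree \<open>d\<close>, hence is the
  degree \<open>d\<close> part of the given element. This is where the arbitrary lower-order part
  \<open>g\<close> disappears.\<close>

lemma linear_form_power_in_initial_ideal: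
  assumes I: "is_ideal I" and mem: "linear_form v ^ d + g \<in> I"
    and g: "\<And>\<alpha>. \<alpha> \<in> Poly_Mapping.keys g \<Longrightarrow> mdeg \<alpha> < d"
  shows "linear_form v ^ d \<in> initial_ideal I"
proof (rule initial_idealI[OF I mem])
  show "\<forall>\<alpha>\<in>Poly_Mapping.keys (linear_form v ^ d + g). mdeg \<alpha> \<le> d"
  proof
    fix \<alpha> assume "\<alpha> \<in> Poly_Mapping.keys (linear_form v ^ d + g)"
    then have "\<alpha> \<in> Poly_Mapping.keys (linear_form v ^ d) \<or> \<alpha> \<in> Poly_Mapping.keys g"
      using Poly_Mapping.keys_add[of "linear_form v ^ d" g] by blast
    then show "mdeg \<alpha> \<le> d"
      using keys_linear_form_power[of \<alpha> v d] g[of \<alpha>] by linarith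
  qed
  fix \<alpha>
  show "Poly_Mapping.lookup (linear_form v ^ d) \<alpha> =
      (if mdeg \<alpha> = d then Poly_Mapping.lookup (linear_form v ^ d + g) \<alpha> else 0)"
  proof (cases "mdeg \<alpha> = d")
    case True
    then have "\<alpha> \<notin> Poly_Mapping.keys g" using g[of \<alpha>] by blast
    then show ?thesis using True by (simp add: lookup_add in_keys_iff)
  next
    case False
    then have "\<alpha> \<notin> Poly_Mapping.keys (linear_form v ^ d)"
      using keys_linear_form_power[of \<alpha> v d] by blast
    then show ?thesis using False by (simp add: in_keys_iff)
  qed
qed

text \<open>With \<open>A\<close> the whole field this product vanishes at every point, and its
  top-degree form is the q-th power of the linear form. That supplies the nilpotency required by
  \<open>admissible\<close>.\<close>

lemma prod_linear_form_minus_const: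
  fixes v :: "'a::{finite,field} ^ 'n::finite"
  assumes "finite A"
  shows "\<exists>r. (\<Prod>c\<in>A. linear_form v - mv_const c) = linear_form v ^ card A + r \<and>
    (\<forall>\<alpha>\<in>Poly_Mapping.keys r. mdeg \<alpha> < card A)"
  using assms
proof (induction A rule: finite_induct)
  case empty
  then show ?case by (intro exI[of _ 0]) simp
next
  case (insert c A)
  let ?h = "linear_form v"
  obtain r where r: "(\<Prod>c\<in>A. ?h - mv_const c) = ?h ^ card A + r"
    "\<And>\<alpha>. \<alpha> \<in> Poly_Mapping.keys r \<Longrightarrow> mdeg \<alpha> < card A" using insert.IH by blast
  let ?r = "?h * r + mv_const (- c) * (?h ^ card A + r)"
  have "mv_const (- c) = - (mv_const c :: ('n, 'a) mvpoly)"
    by (simp add: mv_const_def single_uminus)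
  then have "(\<Prod>c\<in>insert c A. ?h - mv_const c) = ?h ^ card (insert c A) + ?r"
    using insert.hyps r(1) by (simp add: algebra_simps)
  moreover have "mdeg \<alpha> < card (insert c A)" if \<alpha>: "\<alpha> \<in> Poly_Mapping.keys ?r" for \<alpha>
  proof -
    consider "\<alpha> \<in> Poly_Mapping.keys (?h * r)"
      | "\<alpha> \<in> Poly_Mapping.keys (mv_const (- c) * (?h ^ card A + r))"
      using \<alpha> Poly_Mapping.keys_add[of "?h * r"] by blast
    then show ?thesis
    proof cases
      case 1
      then obtain \<beta> \<gamma> where *: "\<alpha> = \<beta> + \<gamma>" "\<beta> \<in> Poly_Mapping.keys ?h" "\<gamma> \<in> Poly_Mapping.keys r"
        using Poly_Mapping.keys_mult[of ?h r] by blast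
      then show ?thesis
        using keys_linear_form[OF *(2)] r(2)[OF *(3)] insert.hyps by (simp add: mdeg_add)
    next
      case 2
      then have "\<alpha> \<in> Poly_Mapping.keys (?h ^ card A + r)"
        by (auto simp: in_keys_iff lookup_const_times)
      then have "\<alpha> \<in> Poly_Mapping.keys (?h ^ card A) \<or> \<alpha> \<in> Poly_Mapping.keys r"
        using Poly_Mapping.keys_add[of "?h ^ card A" r] by blast
      then show ?thesis using keys_linear_form_power[of \<alpha> v] r(2)[of \<alpha>] insert.hyps by auto
    qed
  qed
  ultimately show ?case by blast
qed

lemma admissible_initial_vanishing_ideal:
  "admissible (initial_ideal (vanishing_ideal S))"
  for S :: "('a::{finite,field} ^ 'n::finite) set"
proof -
  have "linear_form v ^ CARD('a) \<in> initial_ideal (vanishing_ideal S)" for v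
  proof -
    obtain r where r: "(\<Prod>c\<in>UNIV. linear_form v - mv_const c) = linear_form v ^ CARD('a) + r"
      "\<And>\<alpha>. \<alpha> \<in> Poly_Mapping.keys r \<Longrightarrow> mdeg \<alpha> < CARD('a)"
      using prod_linear_form_minus_const[of UNIV v] by auto
    \<comment> \<open>At each point the factor whose \<open>c\<close> is the value of the linear
      form there is zero.\<close>
    have "(\<Prod>c\<in>UNIV. linear_form v - mv_const c) \<in> vanishing_ideal S"
      by (auto simp: vanishing_ideal_def mv_eval_prod mv_eval_diff simp del: mv_eval_linear_form)
    then show ?thesis
      unfolding r(1) by (intro linear_form_power_in_initial_ideal[OF is_ideal_vanishing_ideal _ r(2)])
  qed
  then show ?thesis
    by (simp add: admissible_def is_ideal_initial_ideal is_ideal_vanishing_ideal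
        colength_initial_vanishing_ideal)
qed

text \<open>The comparison goes through the rich subset \<open>S'\<close>: its initial ideal has
  colength at least \<open>m\<close> and contains both that of \<open>S\<close> and the
  \<open>d\<close>-th power of the linear form.\<close>

lemma hyper_furstenberg_colength_ge:
  fixes S :: "('a::{finite,field} ^ 'n::finite) set"
  assumes S: "hyper_furstenberg m d S" and d: "d \<ge> 1"
  shows "real m / real d \<le> colength (adjoin (initial_ideal (vanishing_ideal S)) (linear_form v))"
proof -
  obtain g :: "('n, 'a) mvpoly" where g: "mv_degree g \<le> d - 1" "rich S m (linear_form v ^ d + g)"
    using S unfolding hyper_furstenberg_def by blast
  define S' where "S' = hypersurface (linear_form v ^ d + g) \<inter> S"
  let ?J = "initial_ideal (vanishing_ideal S)" and ?J' = "initial_ideal (vanishing_ideal S')"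
  let ?h = "linear_form v"
  note adm = admissible_initial_vanishing_ideal
  have J: "is_ideal ?J" "is_ideal ?J'"
    by (simp_all add: is_ideal_initial_ideal is_ideal_vanishing_ideal)
  have "mdeg \<alpha> < d" if "\<alpha> \<in> Poly_Mapping.keys g" for \<alpha>
  proof -
    have "mdeg \<alpha> \<le> mv_degree g"
      unfolding mv_degree_def mdeg_def using that by (intro Max_ge) auto
    then show ?thesis using g(1) d by linarith
  qed
  moreover have "?h ^ d + g \<in> vanishing_ideal S'"
    by (auto simp: S'_def vanishing_ideal_def hypersurface_def)
  ultimately have mem: "?h ^ d \<in> ?J'"
    using linear_form_power_in_initial_ideal[OF is_ideal_vanishing_ideal] by blast
  have sub: "?J \<subseteq> ?J'"
    by (rule initial_ideal_mono) (auto simp: vanishing_ideal_def S'_def)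
  have adm_d: "admissible (adjoin ?J (?h ^ d))" by (rule admissible_adjoin[OF adm])
  have "real m \<le> colength ?J'"
    using g(2) by (simp add: colength_initial_vanishing_ideal rich_def S'_def)
  also have "\<dots> \<le> colength (adjoin ?J (?h ^ d))"
    by (rule admissible_colength_mono[OF adm_d J(2) adjoin_subset[OF J(2) sub mem]])
  also have "\<dots> \<le> real d * colength (adjoin (adjoin ?J (?h ^ d)) ?h)"
    using adm_d mem_adjoin[OF J(1)] by (intro colength_le_power) (auto simp: admissible_def)
  \<comment> \<open>The previous step was applied to J + (h^d), so \<open>h\<close> has been
    adjoined on top of its own power; dropping that power can only increase the colength.\<close>
  also have "\<dots> \<le> real d * colength (adjoin ?J ?h)"
  proof (intro mult_left_mono admissible_colength_mono admissible_adjoin adm is_ideal_adjoin J)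
    show "adjoin ?J ?h \<subseteq> adjoin (adjoin ?J (?h ^ d)) ?h"
      using subset_adjoin[of ?J "?h ^ d"] by (auto simp: adjoin_def)
  qed simp
  finally show ?thesis using d by (simp add: field_simps)
qed

section \<open>The average colength\<close>

lemma fact_Suc_le_power: "fact (Suc i) \<le> Suc i ^ i"
proof (induction i)
  case (Suc i)
  have "fact (Suc (Suc i)) \<le> Suc (Suc i) * Suc i ^ i"
    using mult_le_mono2[OF Suc.IH, of "Suc (Suc i)"] by (simp only: fact_Suc of_nat_id)
  also have "\<dots> \<le> Suc (Suc i) * Suc (Suc i) ^ i"
    by (intro mult_left_mono power_mono) auto
  finally show ?case by simp
qed simp

text \<open>
  Any family with \<open>excess 1 T \<ge> 2 * T\<close> and the recursive inequality below would do; this one is small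
  enough to keep the final constant independent of the number of variables.
\<close>

definition excess :: "nat \<Rightarrow> nat \<Rightarrow> real"
  where "excess k T = (real k + 1) * real T ^ k / fact k"

text \<open>By Bernoulli, passing from \<open>T\<close> to \<open>T + 1\<close> raises
  \<open>excess (Suc j)\<close> by at least (j + 2) T^j / j!. Of this, (j + 1) T^j / j! is
  \<open>excess j T\<close>, and the remaining T^j / j! is at least \<open>T\<close> because j!
  \<le> T^(j-1) for T \<ge> j.\<close>

lemma excess_step:
  assumes "j \<ge> 1" "T \<ge> j"
  shows "excess (Suc j) T + excess j T + real T \<le> excess (Suc j) (Suc T)"
proof -
  obtain i where i: "j = Suc i" using assms(1) by (cases j) auto
  have "fact j \<le> T ^ i"
    using fact_Suc_le_power[of i] power_mono[OF assms(2), of i] i by (metis le_trans zero_le)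
  then have "(fact j :: real) \<le> real T ^ i"
    by (metis of_nat_fact of_nat_le_iff of_nat_power)
  then have f: "real T * fact j \<le> real T ^ j"
    using i by (simp add: mult_left_mono)
  have ge: "-1 \<le> inverse (real T)" by (rule order.trans[of _ 0]) auto
  have "real T ^ Suc j * (1 + real (Suc j) * inverse (real T)) \<le> real T ^ Suc j * (1 + inverse (real T)) ^ Suc j"
    by (intro mult_left_mono Bernoulli_inequality[OF ge]) auto
  also have "\<dots> = (real T * (1 + inverse (real T))) ^ Suc j" by (simp only: power_mult_distrib)
  also have "real T * (1 + inverse (real T)) = real (Suc T)"
    using assms by (simp add: field_simps)
  also have "real T ^ Suc j * (1 + real (Suc j) * inverse (real T)) = real T ^ Suc j + real (Suc j) * real T ^ j"
    using assms by (simp add: field_simps)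
  finally have b: "real T ^ Suc j + real (Suc j) * real T ^ j \<le> real (Suc T) ^ Suc j" .
  \<comment> \<open>Common denominator (j + 1)! = (j + 1) j!, to be used with \<open>s\<close> = j +
    1 and \<open>F\<close> = j!.\<close>
  have gen: "a / (s * F) + s * b / F + t = (a + s * (s * b + t * F)) / (s * F)"
    if "s > 0" "F > 0" for a b s t F :: real
    using that by (simp add: field_simps)
  have "excess (Suc j) T + excess j T + real T
      = ((real j + 2) * real T ^ Suc j + (real j + 1) * ((real j + 1) * real T ^ j + real T * fact j)) / fact (Suc j)"
    using gen[of "real j + 1" "fact j" "(real j + 2) * real T ^ Suc j" "real T ^ j" "real T"]
    by (simp only: excess_def fact_Suc of_nat_Suc) (simp add: add.commute)
  also have "\<dots> \<le> ((real j + 2) * real T ^ Suc j + (real j + 1) * ((real j + 1) * real T ^ j + real T ^ j)) / fact (Suc j)"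
    using f by (intro divide_right_mono add_left_mono mult_left_mono) auto
  also have "\<dots> = (real j + 2) * (real T ^ Suc j + real (Suc j) * real T ^ j) / fact (Suc j)"
    by (simp add: algebra_simps)
  also have "\<dots> \<le> (real j + 2) * real (Suc T) ^ Suc j / fact (Suc j)"
    by (intro divide_right_mono mult_left_mono b) auto
  also have "\<dots> = excess (Suc j) (Suc T)" by (simp add: excess_def)
  finally show ?thesis .
qed

lemma excess_nonneg: "excess k T \<ge> 0"
  by (simp add: excess_def)

text \<open>
  The hypothesis on \<open>linear_part J\<close> says that \<open>R/J\<close> is generated by \<open>k\<close> linear forms. The
  summand \<open>real T\<close> in the recursion for \<open>excess\<close> pays for the forms \<open>v \<in> linear_part J\<close>, which do
  not lower the number of variables.
\<close>

lemma average_colength_le: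
  fixes J :: "('n::finite, 'a::{finite,field}) mvpoly set"
  assumes "k \<ge> 1" "T \<ge> 1" "admissible J"
    and "CARD('a ^ 'n) \<le> card (linear_part J) * CARD('a) ^ k"
  shows "real T * (\<Sum>v\<in>UNIV. colength (adjoin J (linear_form v)))
    \<le> real CARD('a ^ 'n) * ((real k - 1) * colength J + excess k T)"
  using assms
proof (induction T arbitrary: k J)
  case 0
  then show ?case by simp
next
  case (Suc T)
  let ?Q = "real CARD('a ^ 'n)" and ?N = "colength J"
  let ?l = "\<lambda>v. colength (adjoin J (linear_form v))" and ?L = "linear_part J"
  let ?M = "\<Sum>v\<in>UNIV. ?l v"
  have J: "is_ideal J" "finite_index J" using Suc.prems(3) by (auto simp: admissible_def)
  have Jv: "is_ideal (adjoin J (linear_form v))" for v by (rule is_ideal_adjoin[OF J(1)])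
  have Q: "?Q > 0" by simp
  have N: "?N \<ge> 0" by (rule colength_nonneg[OF J(2)])
  have lN: "?l v \<le> ?N" for v
    by (rule admissible_colength_mono[OF Suc.prems(3) Jv subset_adjoin])
  have l0: "?l v \<ge> 0" for v
    using admissible_adjoin[OF Suc.prems(3)] by (auto simp: admissible_def intro: colength_nonneg)
  have MN: "?M \<le> ?Q * ?N"
    using sum_mono[of UNIV ?l "\<lambda>_. ?N"] lN by simp
  have LN: "(\<Sum>v\<in>UNIV. if v \<in> ?L then ?N else 0) \<le> ?Q"
    using colength_linear_part_le[OF Suc.prems(3)] by (simp add: sum.If_cases mult.commute)
  have cardL: "CARD('a ^ 'n) \<le> card (linear_part (adjoin J (linear_form v))) * CARD('a) ^ j"
    if "v \<notin> ?L" "k = Suc j" for v j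
  proof -
    have "CARD('a ^ 'n) \<le> (CARD('a) * card ?L) * CARD('a) ^ j"
      using Suc.prems(4) that(2) by (simp add: mult_ac)
    also have "\<dots> \<le> card (linear_part (adjoin J (linear_form v))) * CARD('a) ^ j"
      by (intro mult_right_mono card_linear_part_adjoin J that) auto
    finally show ?thesis .
  qed
  \<comment> \<open>One variable is treated directly. For \<open>Suc T < k\<close> the trivial bound
    by \<ell>(J) suffices, since then \<open>Suc T\<close> \<le> k - 1. The remaining range is
    exactly where \<open>excess_step\<close> applies with k = j + 1.\<close>
  consider "k = 1" | "k \<ge> 2" "Suc T < k" | "k \<ge> 2" "Suc T \<ge> k"
    using Suc.prems(1) by linarith
  then show ?case
  proof cases
    case 1
    \<comment> \<open>With one variable, any form outside \<open>?L\<close> generates all linear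
      forms modulo \<open>J\<close>. The forms in \<open>?L\<close> contribute at most
      \<open>?Q\<close> altogether, so the sum is at most twice \<open>?Q\<close>, matching
      \<open>excess 1 T = 2 * T\<close>.\<close>
    have "?l v \<le> 1 + (if v \<in> ?L then ?N else 0)" for v
    proof (cases "v \<in> ?L")
      case True
      then show ?thesis using lN[of v] by simp
    next
      case False
      have "CARD('a ^ 'n) \<le> card (linear_part (adjoin J (linear_form v)))"
        using cardL[OF False, of 0] 1 by simp
      then have "linear_part (adjoin J (linear_form v)) = UNIV"
        by (intro card_seteq) auto
      then show ?thesis using colength_le_1[OF Jv] False by simp
    qed
    then have "?M \<le> (\<Sum>v\<in>UNIV. 1 + (if v \<in> ?L then ?N else 0))"
      by (intro sum_mono)
    also have "\<dots> \<le> ?Q + ?Q"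
      unfolding sum.distrib using LN by simp
    finally have "real (Suc T) * ?M \<le> real (Suc T) * (2 * ?Q)"
      by (intro mult_left_mono) auto
    then show ?thesis using 1 by (simp add: excess_def algebra_simps)
  next
    case 2
    have "real (Suc T) * ?M \<le> (real k - 1) * (?Q * ?N)"
      using 2 MN l0 by (intro mult_mono sum_nonneg) auto
    also have "\<dots> \<le> ?Q * ((real k - 1) * ?N + excess k (Suc T))"
      using Q excess_nonneg[of k "Suc T"] by (simp add: algebra_simps)
    finally show ?thesis .
  next
    case 3
    then obtain j where j: "k = Suc j" "j \<ge> 1" "T \<ge> j" "T \<ge> 1" by (cases k) auto
    let ?c = "\<lambda>g v. colength (adjoin (colon J (linear_form g)) (linear_form v))"
    let ?d = "\<lambda>v g. colength (adjoin (adjoin J (linear_form v)) (linear_form g))"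
    \<comment> \<open>Induction at the same \<open>k\<close> for J : g, whose colength is \<ell>(J)
      - \<ell>(J + (g)).\<close>
    have "real T * (\<Sum>v\<in>UNIV. ?c g v) \<le> ?Q * (real j * (?N - ?l g) + excess k T)" for g
    proof -
      have "CARD('a ^ 'n) \<le> card (linear_part (colon J (linear_form g))) * CARD('a) ^ k"
        using Suc.prems(4) card_mono[OF _ linear_part_mono[OF subset_colon[OF J(1)]]]
        by (meson finite mult_le_mono1 order_trans)
      from Suc.IH[OF Suc.prems(1) j(4) admissible_colon[OF Suc.prems(3)] this]
      show ?thesis
        using colength_adjoin_colon[OF J, of "linear_form g"] j(1) by simp
    qed
    then have "(\<Sum>g\<in>UNIV. real T * (\<Sum>v\<in>UNIV. ?c g v))
        \<le> (\<Sum>g\<in>(UNIV :: ('a ^ 'n) set). ?Q * (real j * (?N - ?l g) + excess k T))"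
      by (intro sum_mono)
    then have c: "real T * (\<Sum>g\<in>UNIV. \<Sum>v\<in>UNIV. ?c g v)
        \<le> ?Q * (real j * (?Q * ?N - ?M) + ?Q * excess k T)"
      by (simp only: sum.distrib sum_subtractf sum_constant flip: sum_distrib_left)
    \<comment> \<open>For \<open>v\<close> outside \<open>?L\<close> the ideal J + (v) has one
      variable less and induction applies with \<open>j\<close>. For \<open>v\<close> in
      \<open>?L\<close> the trivial bound \<open>?N\<close> is used; \<open>LN\<close> shows that
      these cost at most \<open>?Q\<close> in total.\<close>
    have "real T * (\<Sum>g\<in>UNIV. ?d v g)
        \<le> ?Q * ((real j - 1) * ?l v + excess j T) + real T * ?Q * (if v \<in> ?L then ?N else 0)" for v
    proof (cases "v \<in> ?L")
      case True
      have "?d v g \<le> ?N" for g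
        using lN[of v] admissible_colength_mono[OF admissible_adjoin[OF Suc.prems(3)]
            is_ideal_adjoin[OF Jv] subset_adjoin, of v "linear_form g"] by linarith
      then have "(\<Sum>g\<in>UNIV. ?d v g) \<le> ?Q * ?N"
        using sum_mono[of UNIV "?d v" "\<lambda>_. ?N"] by simp
      then have "real T * (\<Sum>g\<in>UNIV. ?d v g) \<le> real T * (?Q * ?N)"
        by (rule mult_left_mono) simp
      moreover have "?Q * ((real j - 1) * ?l v + excess j T) \<ge> 0"
        using l0[of v] j excess_nonneg[of j T] by simp
      ultimately show ?thesis using True by simp
    next
      case False
      from Suc.IH[OF j(2,4) admissible_adjoin[OF Suc.prems(3)] cardL[OF False j(1)]] False
      show ?thesis by simp
    qed
    then have "(\<Sum>v\<in>UNIV. real T * (\<Sum>g\<in>UNIV. ?d v g))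
        \<le> (\<Sum>v\<in>UNIV. ?Q * ((real j - 1) * ?l v + excess j T) + real T * ?Q * (if v \<in> ?L then ?N else 0))"
      by (intro sum_mono)
    then have "real T * (\<Sum>v\<in>UNIV. \<Sum>g\<in>UNIV. ?d v g)
        \<le> ?Q * ((real j - 1) * ?M + ?Q * excess j T)
          + real T * ?Q * (\<Sum>v\<in>UNIV. if v \<in> ?L then ?N else 0)"
      by (simp only: sum.distrib sum_constant flip: sum_distrib_left)
    also have "\<dots> \<le> ?Q * ((real j - 1) * ?M + ?Q * excess j T) + real T * ?Q * ?Q"
      by (intro add_left_mono mult_left_mono LN) auto
    finally have d: "real T * (\<Sum>v\<in>UNIV. \<Sum>g\<in>UNIV. ?d v g)
        \<le> ?Q * ((real j - 1) * ?M + ?Q * excess j T) + real T * ?Q * ?Q" .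
    \<comment> \<open>The left side is \<ell>((J + (v)) : g), and (J : g) + (v) is contained in that
      colon ideal.\<close>
    have "?l v - ?d v g \<le> ?c g v" for v g
    proof -
      have "?l v = ?d v g + colength (colon (adjoin J (linear_form v)) (linear_form g))"
        using admissible_adjoin[OF Suc.prems(3)]
        by (intro colength_adjoin_colon) (auto simp: admissible_def)
      moreover have "colength (colon (adjoin J (linear_form v)) (linear_form g)) \<le> ?c g v"
        by (intro admissible_colength_mono admissible_adjoin admissible_colon Suc.prems
            is_ideal_colon Jv adjoin_colon_subset J)
      ultimately show ?thesis by linarith
    qed
    then have "(\<Sum>v\<in>UNIV. \<Sum>g\<in>UNIV. ?l v - ?d v g) \<le> (\<Sum>v\<in>UNIV. \<Sum>g\<in>UNIV. ?c g v)"
      by (intro sum_mono)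
    then have "?Q * ?M - (\<Sum>v\<in>UNIV. \<Sum>g\<in>UNIV. ?d v g) \<le> (\<Sum>g\<in>UNIV. \<Sum>v\<in>UNIV. ?c g v)"
      by (subst (2) sum.swap) (simp add: sum_subtractf flip: sum_distrib_left)
    then have "real T * (?Q * ?M - (\<Sum>v\<in>UNIV. \<Sum>g\<in>UNIV. ?d v g))
        \<le> real T * (\<Sum>g\<in>UNIV. \<Sum>v\<in>UNIV. ?c g v)"
      by (rule mult_left_mono) simp
    then have "real T * (?Q * ?M)
        \<le> ?Q * (real j * (?Q * ?N - ?M) + ?Q * excess k T)
          + (?Q * ((real j - 1) * ?M + ?Q * excess j T) + real T * ?Q * ?Q)"
      using c d by (simp only: right_diff_distrib)
    \<comment> \<open>The coefficients -j and j - 1 of \<open>?M\<close> on the right add up to -1;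
      moving this term to the left turns the factor \<open>T\<close> into
      \<open>Suc T\<close>.\<close>
    then have "?Q * (real (Suc T) * ?M)
        \<le> ?Q * (?Q * (real j * ?N + (excess k T + excess j T + real T)))"
      by (simp add: algebra_simps)
    then have "real (Suc T) * ?M \<le> ?Q * (real j * ?N + (excess k T + excess j T + real T))"
      using Q by (simp only: mult_le_cancel_left_pos)
    also have "\<dots> \<le> ?Q * (real j * ?N + excess k (Suc T))"
      using excess_step[OF j(2,3)] j(1) by (intro mult_left_mono add_left_mono) auto
    finally show ?thesis using j(1) by simp
  qed
qed

section \<open>From the linear inequalities to the power bound\<close>

lemma power_le_fact: "n \<ge> 2 \<Longrightarrow> 16 * (5 * real n / 32) ^ n \<le> fact n"
proof (induction n rule: dec_induct)
  case base
  then show ?case by (simp add: power2_eq_square)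
next
  case (step n)
  have n: "real n > 0" using step.hyps by simp
  \<comment> \<open>From \<open>n\<close> to \<open>n + 1\<close> the left side of the claim grows
    by (1 + 1/n)^n * 5 (n + 1) / 32, which must not exceed n + 1. So it suffices that e \<le>
    32/5.\<close>
  have "(1 + inverse (real n)) ^ n \<le> exp (inverse (real n)) ^ n"
    by (intro power_mono exp_ge_add_one_self) auto
  also have "\<dots> = exp 1" using n by (simp flip: exp_of_nat_mult)
  also have "\<dots> \<le> 3" by (rule exp_le)
  finally have e: "(1 + inverse (real n)) ^ n \<le> 32 / 5" by simp
  have "16 * (5 * real (Suc n) / 32) ^ Suc n
      = 16 * (5 * real n / 32) ^ n * ((1 + inverse (real n)) ^ n * (5 * real (Suc n) / 32))"
  proof -
    have "5 * real (Suc n) / 32 = (5 * real n / 32) * (1 + inverse (real n))"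
      using n by (simp add: field_simps)
    then have "(5 * real (Suc n) / 32) ^ n = (5 * real n / 32) ^ n * (1 + inverse (real n)) ^ n"
      by (simp only: power_mult_distrib)
    then show ?thesis by (simp only: power_Suc mult_ac)
  qed
  also have "\<dots> \<le> fact n * (32 / 5 * (5 * real (Suc n) / 32))"
    using e by (intro mult_mono step.IH mult_right_mono) auto
  also have "\<dots> = fact (Suc n)" by (simp add: algebra_simps)
  finally show ?case .
qed

text \<open>With \<open>y\<close> the (n - 1)-th root of \<open>\<mu>\<close>, the claim reads y^n /
  16 \<le> N. If it failed, the inequality for \<open>T\<close> near n y / 8 would be contradictory:
  its left side is at least n y^n / 8 and its right side is smaller.\<close>

lemma powr_bound_from_excess:
  fixes \<mu> N :: real
  assumes n: "n \<ge> 2" and \<mu>: "\<mu> > 0" "\<mu> \<le> N"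
    and T: "\<And>T. T \<ge> 1 \<Longrightarrow> real T * \<mu> \<le> (real n - 1) * N + excess n T"
  shows "\<mu> powr (real n / (real n - 1)) / 16 \<le> N"
proof -
  define y where "y = \<mu> powr (1 / (real n - 1))"
  have y: "y > 0" using \<mu> by (simp add: y_def)
  have "y ^ (n - 1) = \<mu> powr (1 / (real n - 1) * real (n - 1))"
    using y by (simp add: y_def powr_powr flip: powr_realpow)
  then have y\<mu>: "y ^ (n - 1) = \<mu>" using n \<mu> by (simp add: of_nat_diff)
  have yn: "y ^ n = y * \<mu>" using n by (simp flip: y\<mu> power_Suc)
  have "y ^ n = \<mu> powr (1 / (real n - 1) * real n)"
    using y by (simp add: y_def powr_powr flip: powr_realpow)
  then have p: "\<mu> powr (real n / (real n - 1)) = y ^ n" by simp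
  show ?thesis
  proof (cases "y \<le> 16")
    case True
    \<comment> \<open>For small \<open>y\<close> the hypothesis \<open>\<mu> \<le> N\<close> already
      suffices, as y^n = y \<mu>.\<close>
    then have "y ^ n \<le> 16 * \<mu>" using \<mu>(1) by (simp add: yn)
    then show ?thesis using \<mu>(2) by (simp add: p)
  next
    case False
    show ?thesis
    proof (rule ccontr)
      assume "\<not> ?thesis"
      then have N: "N < y ^ n / 16" by (simp add: p)
      define T where "T = nat \<lceil>real n * y / 8\<rceil>"
      have pos: "real n * y / 8 > 0" using n y by simp
      then have T1: "T \<ge> 1" by (simp add: T_def Suc_le_eq)
      have T_lo: "real n * y / 8 \<le> real T" unfolding T_def by linarith
      have "real T \<le> real n * y / 8 + 1" using pos unfolding T_def by linarith
      \<comment> \<open>The rounding error 1 is absorbed because y > 16; two lines on, 2n + 1 \<le>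
        5n/2 uses n \<ge> 2. Together they produce the constant 5/32.\<close>
      also have "\<dots> \<le> real n * y / 8 + y / 16" using False by simp
      also have "\<dots> = y * (2 * real n + 1) / 16" by (simp add: field_simps)
      also have "\<dots> \<le> y * (5 * real n / 2) / 16" using y n by simp
      finally have T_hi: "real T \<le> y * (5 * real n / 32)" by simp
      have "real n * y ^ n / 8 = (real n * y / 8) * \<mu>" by (simp add: yn)
      also have "\<dots> \<le> real T * \<mu>" using T_lo \<mu>(1) by (intro mult_right_mono) auto
      also have "\<dots> \<le> (real n - 1) * N + excess n T" by (rule T[OF T1])
      also have "\<dots> < (real n - 1) * (y ^ n / 16) + excess n T"
        using N n by simp
      also have "excess n T \<le> (real n + 1) * (y * (5 * real n / 32)) ^ n / fact n"
        unfolding excess_def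
        by (intro divide_right_mono mult_left_mono power_mono T_hi) auto
      also have "\<dots> = (real n + 1) * y ^ n * ((5 * real n / 32) ^ n / fact n)"
        by (subst power_mult_distrib) (simp add: mult.assoc)
      \<comment> \<open>The right side is now (n - 1) y^n / 16 + (n + 1) y^n / 16 = n y^n / 8,
        exactly the left end of the strict chain.\<close>
      also have "\<dots> \<le> (real n + 1) * y ^ n * (1 / 16)"
        using power_le_fact[OF n] y by (intro mult_left_mono) (auto simp: field_simps)
      finally show False by (simp add: field_simps)
    qed
  qed
qed

theorem theorem1p7:
  fixes S :: "('a::{finite,field} ^ 'n::finite) set" and m d :: nat
  assumes "CARD('n) \<ge> 2" and "m \<ge> 1" and "d \<ge> 1"
    and "hyper_furstenberg m d S"
  shows "real (card S) \<ge>
    inverse (16 * real d powr (real CARD('n) / (real CARD('n) - 1))) *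
      real m powr (real CARD('n) / (real CARD('n) - 1))"
proof -
  let ?J = "initial_ideal (vanishing_ideal S)" and ?\<mu> = "real m / real d"
  let ?l = "\<lambda>v. colength (adjoin ?J (linear_form v))" and ?Q = "real CARD('a ^ 'n)"
  note adm = admissible_initial_vanishing_ideal[of S]
  have J: "is_ideal ?J" using adm by (simp add: admissible_def)
  have N: "colength ?J = real (card S)" by (rule colength_initial_vanishing_ideal)
  have ge: "?\<mu> \<le> ?l v" for v by (rule hyper_furstenberg_colength_ge[OF assms(4,3)])
  have "?\<mu> \<le> colength ?J"
    using ge[of 0] admissible_colength_mono[OF adm is_ideal_adjoin[OF J] subset_adjoin] by (rule order.trans)
  moreover have "real T * ?\<mu> \<le> (real CARD('n) - 1) * colength ?J + excess CARD('n) T" if "T \<ge> 1" for T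
  proof -
    \<comment> \<open>The averaging bound is applied with \<open>k\<close> equal to the number of
      variables, where its hypothesis only asks that the linear part be nonempty.\<close>
    have "card (linear_part ?J) \<ge> 1"
      using zero_in_linear_part[OF J] by (auto simp: Suc_le_eq card_gt_0_iff)
    then have "CARD('a ^ 'n) \<le> card (linear_part ?J) * CARD('a) ^ CARD('n)"
      by simp
    then have le: "real T * (\<Sum>v\<in>UNIV. ?l v)
        \<le> ?Q * ((real CARD('n) - 1) * colength ?J + excess CARD('n) T)"
      using assms(1) that adm by (intro average_colength_le) auto
    \<comment> \<open>Every linear form, the zero form included, satisfies the lower bound, so the
      average does too.\<close>
    have "?Q * ?\<mu> \<le> (\<Sum>v\<in>UNIV. ?l v)"
      using sum_mono[of UNIV "\<lambda>_. ?\<mu>" ?l] ge by simp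
    then have "real T * (?Q * ?\<mu>) \<le> real T * (\<Sum>v\<in>UNIV. ?l v)"
      by (rule mult_left_mono) simp
    then have "?Q * (real T * ?\<mu>) \<le> ?Q * ((real CARD('n) - 1) * colength ?J + excess CARD('n) T)"
      using le by (simp only: mult.left_commute[of "real T" ?Q])
    then show ?thesis
      by (subst (asm) mult_le_cancel_left_pos) simp_all
  qed
  \<comment> \<open>Here \<open>\<mu>\<close> is m/d and \<open>N\<close> is the size of
    \<open>S\<close>; the power of \<open>d\<close> in the constant comes from the denominator of
    \<open>\<mu>\<close>.\<close>
  ultimately have "?\<mu> powr (real CARD('n) / (real CARD('n) - 1)) / 16 \<le> colength ?J"
    using assms(1-3) by (intro powr_bound_from_excess) auto
  then show ?thesis
    by (simp add: N powr_divide field_simps)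
qed

end
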